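(* Let $\mathcal{AC}$ be the category of abstract clones, let $\mathcal{SA}$ be the category of substitution algebras in the object-classifier topos $\mathcal{S}et^{\mathbb{F}}$, and let $\mathrm{S}:\mathcal{AC}\to\mathcal{SA}$ and $\mathrm{C}:\mathcal{SA}\to\mathcal{AC}$ be the functors described in the context. Then $\mathrm{S}$ and $\mathrm{C}$ form an isomorphism of categories, that is, $\mathrm{C}\circ\mathrm{S}=\mathrm{Id}_{\mathcal{AC}}$ and $\mathrm{S}\circ\mathrm{C}=\mathrm{Id}_{\mathcal{SA}}$.
   Context: **The category $\mathbb{F}$.** Write $[\ell]=\{k\in\mathbb{N}\mid k<\ell\}$. $\mathbb{F}$ has the natural numbers as objects and functions $[m]\to[n]$ as morphisms $m\to n$. It has chosen coproducts $m+n$ given by addition, with injections $i\mapsto i$ on $[m]$ and $j\mapsto m+j$ on $[n]$. In particular, for $f:m\to n$, $f+\mathrm{id}_1:m+1\to n+1$ is $f$ on $[m]$ and sends $m\mapsto n$. Let $\mathrm{c}:2\to1$ and $\mathrm{w}:0\to1$ be the unique maps and let $\mathrm{s}:2\to2$ be the transposition. **Abstract clones.** An abstract clone $(C,\mu,\iota)$ consists of sets $\{C_n\}_{n\in\mathbb{N}}$, functions $\mu_{m,n}:C_m\times(C_n)^m\to C_n$ ($m,n\in\mathbb{N}$) and elements $\iota^m_i\in C_m$ ($m\in\mathbb{N}$, $i\in[m]$) such that, for all $\ell,m,n$ and all elements of the appropriate sets, - $\mu_{m,n}(\mu_{\ell,m}(x,y_0,\ldots,y_{\ell-1}),z_0,\ldots,z_{m-1})=\mu_{\ell,n}(x,\mu_{m,n}(y_0,z_0,\ldots,z_{m-1}),\ldots,\mu_{m,n}(y_{\ell-1},z_0,\ldots,z_{m-1}))$,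 for $x\in C_\ell$, $y_j\in C_m$, $z_k\in C_n$; - $\mu_{m,n}(\iota^m_i,x_0,\ldots,x_{m-1})=x_i$, for $x_j\in C_n$; - $\mu_{m,m}(x,\iota^m_0,\ldots,\iota^m_{m-1})=x$, for $x\in C_m$. A homomorphism is a family of functions $h_m:C_m\to C'_m$ preserving all $\mu_{m,n}$ and $\iota^m_i$. $\mathcal{AC}$ is the category of abstract clones and homomorphisms. **Substitution algebras.** A substitution algebra $(A,s,v)$ is a functor $A:\mathbb{F}\to\mathcal{S}et$ together with functions $s_m:A(m+1)\times A(m)\to A(m)$ and elements $v_m\in A(m+1)$ (also written as maps $v_m:1\to A(m+1)$), for $m\in\mathbb{N}$, natural in $m\in\mathbb{F}$, i.e. for all $f:m\to n$ in $\mathbb{F}$, $A(f)(s_m(x,y))=s_n(A(f+\mathrm{id}_1)(x),A(f)(y))$ and $A(f+\mathrm{id}_1)(v_m)=v_n$, such that for all $m$: - $s_m(v_m,x)=x$ for $x\in A(m)$; - $s_{m+1}(x,v_m)=A(\mathrm{id}_m+\mathrm{c})(x)$ for $x\in A(m+2)$; - $s_m(A(\mathrm{id}_m+\mathrm{w})(x),y)=x$ for $x,y\in A(m)$; - $s_m(s_{m+1}(x,y),z)=s_m\big(s_{m+1}(A(\mathrm{id}_m+\mathrm{s})(x),A(\mathrm{id}_m+\mathrm{w})(z)),s_m(y,z)\big)$ for $x\in A(m+2)$, $y\in A(m+1)$, $z\in A(m)$. (This is the explicit form of a substitution algebra for the symmetric monad $(-)^V$ on $\mathcal{S}et^{\mathbb{F}}$,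 $V=\mathbb{F}(1,-)$, via the identification $A^V\cong A(-+1)$.) A homomorphism $(A,s,v)\to(A',s',v')$ is a natural transformation $h:A\to A'$ with $h_{m+1}(v_m)=v'_m$ and $h_m(s_m(x,y))=s'_m(h_{m+1}(x),h_m(y))$ for all $m,x,y$. $\mathcal{SA}$ is the category of substitution algebras and homomorphisms. **The functor $\mathrm{S}:\mathcal{AC}\to\mathcal{SA}$.** $\mathrm{S}(C,\mu,\iota)=(C,s,v)$ where $C(m)=C_m$; for $f\in\mathbb{F}(m,n)$, $C(f)(t)=\mu_{m,n}(t,\iota^n_{f(0)},\ldots,\iota^n_{f(m-1)})$; $v_m=\iota^{m+1}_m$; and $s_m(t,u)=\mu_{m+1,m}(t,\iota^m_0,\ldots,\iota^m_{m-1},u)$. On homomorphisms $\mathrm{S}(h)=\{h_m\}_{m\in\mathbb{N}}$. **The functor $\mathrm{C}:\mathcal{SA}\to\mathcal{AC}$.** Given $(A,s,v)$, define $\varphi_{m,n}:A(n+m)\times A(n)^m\to A(n)$ by induction on $m$: $\varphi_{0,n}(t)=t$ and $$\varphi_{m+1,n}(t,u_0,\ldots,u_m)=\varphi_{m,n}\big(s_{n+m}(t,A(j)(u_m)),u_0,\ldots,u_{m-1}\big),$$ where $j:n\to n+m$ is $i\mapsto i$. Then $\mathrm{C}(A,s,v)=(A,\mu,\iota)$, with underlying sets $A(m)$, where $\mu_{m,n}(t,u_0,\ldots,u_{m-1})=\varphi_{m,n}(A(k)(t),u_0,\ldots,u_{m-1})$ with $k:m\to n+m$ given by $i\mapsto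 n+i$, and $\iota^m_i=A(0\mapsto i)(v_0)\in A(m)$, where $(0\mapsto i):1\to m$ and $v_0\in A(1)$. On homomorphisms $\mathrm{C}(h)=\{h_m\}_{m\in\mathbb{N}}$. *)

theory Defs
  imports "HOL-Library.FuncSet"
begin

section \<open>Categories and functors\<close>

text \<open>
  Hom-sets are indexed by source and target and need not be disjoint. All functions with a
  prescribed domain are extensional (the value is \<^const>\<open>undefined\<close> outside the domain), so that
  equality in HOL is equality of the structures themselves. In \<open>cmp \<C> X Y Z g f\<close> we have
  \<open>f : X \<rightarrow> Y\<close> and \<open>g : Y \<rightarrow> Z\<close>.
\<close>

record ('o, 'm) cat =
  obj :: "'o set"
  hom :: "'o \<Rightarrow> 'o \<Rightarrow> 'm set"
  idn :: "'o \<Rightarrow> 'm"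
  cmp :: "'o \<Rightarrow> 'o \<Rightarrow> 'o \<Rightarrow> 'm \<Rightarrow> 'm \<Rightarrow> 'm"

locale category =
  fixes \<C> :: "('o, 'm) cat"
  assumes idn_hom: "X \<in> obj \<C> \<Longrightarrow> idn \<C> X \<in> hom \<C> X X"
    and cmp_hom: "\<lbrakk>X \<in> obj \<C>; Y \<in> obj \<C>; Z \<in> obj \<C>; f \<in> hom \<C> X Y; g \<in> hom \<C> Y Z\<rbrakk>
      \<Longrightarrow> cmp \<C> X Y Z g f \<in> hom \<C> X Z"
    and cmp_idn_right: "\<lbrakk>X \<in> obj \<C>; Y \<in> obj \<C>; f \<in> hom \<C> X Y\<rbrakk>
      \<Longrightarrow> cmp \<C> X X Y f (idn \<C> X) = f"
    and cmp_idn_left: "\<lbrakk>X \<in> obj \<C>; Y \<in> obj \<C>; f \<in> hom \<C> X Y\<rbrakk>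
      \<Longrightarrow> cmp \<C> X Y Y (idn \<C> Y) f = f"
    and cmp_assoc: "\<lbrakk>W \<in> obj \<C>; X \<in> obj \<C>; Y \<in> obj \<C>; Z \<in> obj \<C>;
        f \<in> hom \<C> W X; g \<in> hom \<C> X Y; h \<in> hom \<C> Y Z\<rbrakk>
      \<Longrightarrow> cmp \<C> W Y Z h (cmp \<C> W X Y g f) = cmp \<C> W X Z (cmp \<C> X Y Z h g) f"

record ('o, 'm, 'p, 'n) func =
  fobj :: "'o \<Rightarrow> 'p"
  farr :: "'o \<Rightarrow> 'o \<Rightarrow> 'm \<Rightarrow> 'n"

locale cat_functor = source: category \<C> + target: category \<D>
  for \<C> :: "('o, 'm) cat" and \<D> :: "('p, 'n) cat" +
  fixes F :: "('o, 'm, 'p, 'n) func"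
  assumes fobj_type: "fobj F \<in> obj \<C> \<rightarrow>\<^sub>E obj \<D>"
    and farr_type: "farr F \<in> (\<Pi>\<^sub>E X \<in> obj \<C>. \<Pi>\<^sub>E Y \<in> obj \<C>.
      hom \<C> X Y \<rightarrow>\<^sub>E hom \<D> (fobj F X) (fobj F Y))"
    and farr_idn: "X \<in> obj \<C> \<Longrightarrow> farr F X X (idn \<C> X) = idn \<D> (fobj F X)"
    and farr_cmp: "\<lbrakk>X \<in> obj \<C>; Y \<in> obj \<C>; Z \<in> obj \<C>; f \<in> hom \<C> X Y; g \<in> hom \<C> Y Z\<rbrakk>
      \<Longrightarrow> farr F X Z (cmp \<C> X Y Z g f)
        = cmp \<D> (fobj F X) (fobj F Y) (fobj F Z) (farr F Y Z g) (farr F X Y f)"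

definition id_func :: "('o, 'm) cat \<Rightarrow> ('o, 'm, 'o, 'm) func" where
  "id_func \<C> = \<lparr>fobj = (\<lambda>X\<in>obj \<C>. X),
     farr = (\<lambda>X\<in>obj \<C>. \<lambda>Y\<in>obj \<C>. \<lambda>f\<in>hom \<C> X Y. f)\<rparr>"

definition comp_func :: "('o, 'm) cat \<Rightarrow> ('p, 'n, 'q, 'k) func \<Rightarrow> ('o, 'm, 'p, 'n) func
    \<Rightarrow> ('o, 'm, 'q, 'k) func" where
  "comp_func \<C> G F = \<lparr>fobj = (\<lambda>X\<in>obj \<C>. fobj G (fobj F X)),
     farr = (\<lambda>X\<in>obj \<C>. \<lambda>Y\<in>obj \<C>. \<lambda>f\<in>hom \<C> X Y.
       farr G (fobj F X) (fobj F Y) (farr F X Y f))\<rparr>"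

definition nat_trans :: "('o, 'm) cat \<Rightarrow> ('p, 'n) cat \<Rightarrow> ('o, 'm, 'p, 'n) func
    \<Rightarrow> ('o, 'm, 'p, 'n) func \<Rightarrow> ('o \<Rightarrow> 'n) \<Rightarrow> bool" where
  "nat_trans \<C> \<D> F G h \<longleftrightarrow>
     h \<in> (\<Pi>\<^sub>E X \<in> obj \<C>. hom \<D> (fobj F X) (fobj G X)) \<and>
     (\<forall>X \<in> obj \<C>. \<forall>Y \<in> obj \<C>. \<forall>f \<in> hom \<C> X Y.
        cmp \<D> (fobj F X) (fobj F Y) (fobj G Y) (h Y) (farr F X Y f)
      = cmp \<D> (fobj F X) (fobj G X) (fobj G Y) (farr G X Y f) (h X))"

text \<open>
  The type \<open>'a\<close> plays the role of the universe: the sets under consideration are the subsets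
  of \<open>'a\<close>. The empty set is included.
\<close>

definition SET :: "('a set, 'a \<Rightarrow> 'a) cat" where
  "SET = \<lparr>obj = UNIV, hom = (\<lambda>X Y. X \<rightarrow>\<^sub>E Y), idn = (\<lambda>X. \<lambda>x\<in>X. x),
     cmp = (\<lambda>X Y Z g f. compose X g f)\<rparr>"

lemma category_SET: "category SET"
  by unfold_locales
    (auto simp: SET_def compose_def restrict_def fun_eq_iff PiE_iff extensional_def)


section \<open>The category of finite ordinals\<close>

definition FF :: "(nat, nat \<Rightarrow> nat) cat" where
  "FF = \<lparr>obj = UNIV, hom = (\<lambda>m n. {..<m} \<rightarrow>\<^sub>E {..<n}), idn = (\<lambda>m. \<lambda>i\<in>{..<m}. i),
     cmp = (\<lambda>l m n g f. compose {..<l} g f)\<rparr>"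

lemma category_FF: "category FF"
  by unfold_locales
    (auto simp: FF_def compose_def restrict_def fun_eq_iff PiE_iff extensional_def)

text \<open>\<open>fplus m m' n f g : m + m' \<rightarrow> n + n'\<close> is \<open>f + g\<close> for \<open>f : m \<rightarrow> n\<close> and \<open>g : m' \<rightarrow> n'\<close>.\<close>

definition fplus :: "nat \<Rightarrow> nat \<Rightarrow> nat \<Rightarrow> (nat \<Rightarrow> nat) \<Rightarrow> (nat \<Rightarrow> nat) \<Rightarrow> nat \<Rightarrow> nat" where
  "fplus m m' n f g = (\<lambda>i\<in>{..<m + m'}. if i < m then f i else n + g (i - m))"

definition finl :: "nat \<Rightarrow> nat \<Rightarrow> nat" where
  "finl m = (\<lambda>i\<in>{..<m}. i)"

definition finr :: "nat \<Rightarrow> nat \<Rightarrow> nat \<Rightarrow> nat" where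
  "finr m n = (\<lambda>j\<in>{..<n}. m + j)"

definition contr :: "nat \<Rightarrow> nat" where
  "contr = (\<lambda>i\<in>{..<2}. 0)"

definition weak :: "nat \<Rightarrow> nat" where
  "weak = (\<lambda>i\<in>{..<0}. 0)"

definition swap2 :: "nat \<Rightarrow> nat" where
  "swap2 = (\<lambda>i\<in>{..<2}. 1 - i)"

definition point :: "nat \<Rightarrow> nat \<Rightarrow> nat" where
  "point i = (\<lambda>_\<in>{..<1}. i)"


section \<open>Abstract clones\<close>

text \<open>A tuple in \<open>X\<^sup>m\<close> is an element of \<open>{..<m} \<rightarrow>\<^sub>E X\<close>.\<close>

record 'a clone =
  cset :: "nat \<Rightarrow> 'a set"
  mu :: "nat \<Rightarrow> nat \<Rightarrow> 'a \<Rightarrow> (nat \<Rightarrow> 'a) \<Rightarrow> 'a"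
  iota :: "nat \<Rightarrow> nat \<Rightarrow> 'a"

locale abstract_clone =
  fixes C :: "'a clone"
  assumes mu_type: "mu C m n \<in> cset C m \<rightarrow>\<^sub>E ({..<m} \<rightarrow>\<^sub>E cset C n) \<rightarrow>\<^sub>E cset C n"
    and iota_type: "iota C m \<in> {..<m} \<rightarrow>\<^sub>E cset C m"
    and mu_assoc: "\<lbrakk>x \<in> cset C l; y \<in> {..<l} \<rightarrow>\<^sub>E cset C m; z \<in> {..<m} \<rightarrow>\<^sub>E cset C n\<rbrakk>
      \<Longrightarrow> mu C m n (mu C l m x y) z = mu C l n x (\<lambda>j\<in>{..<l}. mu C m n (y j) z)"
    and mu_iota_left: "\<lbrakk>i < m; y \<in> {..<m} \<rightarrow>\<^sub>E cset C n\<rbrakk> \<Longrightarrow> mu C m n (iota C m i) y = y i"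
    and mu_iota_right: "x \<in> cset C m \<Longrightarrow> mu C m m x (iota C m) = x"

definition clone_hom :: "'a clone \<Rightarrow> 'a clone \<Rightarrow> (nat \<Rightarrow> 'a \<Rightarrow> 'a) \<Rightarrow> bool" where
  "clone_hom C C' h \<longleftrightarrow>
     (\<forall>m. h m \<in> cset C m \<rightarrow>\<^sub>E cset C' m) \<and>
     (\<forall>m n. \<forall>x \<in> cset C m. \<forall>y \<in> {..<m} \<rightarrow>\<^sub>E cset C n.
        h n (mu C m n x y) = mu C' m n (h m x) (\<lambda>j\<in>{..<m}. h n (y j))) \<and>
     (\<forall>m. \<forall>i<m. h m (iota C m i) = iota C' m i)"

definition AC :: "('a clone, nat \<Rightarrow> 'a \<Rightarrow> 'a) cat" where
  "AC = \<lparr>obj = {C. abstract_clone C}, hom = (\<lambda>C C'. {h. clone_hom C C' h}),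
     idn = (\<lambda>C m. \<lambda>x\<in>cset C m. x),
     cmp = (\<lambda>C C' C'' g h m. compose (cset C m) (g m) (h m))\<rparr>"


section \<open>Substitution algebras\<close>

text \<open>
  Substitution algebras in the presheaf topos of functors \<open>FF \<rightarrow> SET\<close>, in the explicit form obtained
  from the identification of the exponential \<open>A\<^sup>V\<close>, \<open>V = FF(1, -)\<close>, with \<open>A(- + 1)\<close>: the variable
  bound by \<open>sub A m\<close> is the last one, with index \<open>m\<close>.
\<close>

record 'a subst_alg =
  psh :: "(nat, nat \<Rightarrow> nat, 'a set, 'a \<Rightarrow> 'a) func"
  sub :: "nat \<Rightarrow> 'a \<Rightarrow> 'a \<Rightarrow> 'a"
  var :: "nat \<Rightarrow> 'a"

abbreviation aset :: "'a subst_alg \<Rightarrow> nat \<Rightarrow> 'a set" where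
  "aset A \<equiv> fobj (psh A)"

abbreviation act :: "'a subst_alg \<Rightarrow> nat \<Rightarrow> nat \<Rightarrow> (nat \<Rightarrow> nat) \<Rightarrow> 'a \<Rightarrow> 'a" where
  "act A \<equiv> farr (psh A)"

locale substitution_algebra =
  fixes A :: "'a subst_alg"
  assumes psh_functor: "cat_functor FF SET (psh A)"
    and sub_type: "sub A m \<in> aset A (m + 1) \<rightarrow>\<^sub>E aset A m \<rightarrow>\<^sub>E aset A m"
    and var_type: "var A m \<in> aset A (m + 1)"
    and sub_natural: "\<lbrakk>f \<in> hom FF m n; x \<in> aset A (m + 1); y \<in> aset A m\<rbrakk>
      \<Longrightarrow> act A m n f (sub A m x y)
        = sub A n (act A (m + 1) (n + 1) (fplus m 1 n f (idn FF 1)) x) (act A m n f y)"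
    and var_natural: "f \<in> hom FF m n
      \<Longrightarrow> act A (m + 1) (n + 1) (fplus m 1 n f (idn FF 1)) (var A m) = var A n"
    and sub_var_left: "x \<in> aset A m \<Longrightarrow> sub A m (var A m) x = x"
    and sub_var_right: "x \<in> aset A (m + 2)
      \<Longrightarrow> sub A (m + 1) x (var A m) = act A (m + 2) (m + 1) (fplus m 2 m (idn FF m) contr) x"
    and sub_weak: "\<lbrakk>x \<in> aset A m; y \<in> aset A m\<rbrakk>
      \<Longrightarrow> sub A m (act A m (m + 1) (fplus m 0 m (idn FF m) weak) x) y = x"
    and sub_sub: "\<lbrakk>x \<in> aset A (m + 2); y \<in> aset A (m + 1); z \<in> aset A m\<rbrakk>
      \<Longrightarrow> sub A m (sub A (m + 1) x y) z
        = sub A m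
            (sub A (m + 1) (act A (m + 2) (m + 2) (fplus m 2 m (idn FF m) swap2) x)
              (act A m (m + 1) (fplus m 0 m (idn FF m) weak) z))
            (sub A m y z)"

definition subst_alg_hom :: "'a subst_alg \<Rightarrow> 'a subst_alg \<Rightarrow> (nat \<Rightarrow> 'a \<Rightarrow> 'a) \<Rightarrow> bool" where
  "subst_alg_hom A A' h \<longleftrightarrow>
     nat_trans FF SET (psh A) (psh A') h \<and>
     (\<forall>m. h (m + 1) (var A m) = var A' m) \<and>
     (\<forall>m. \<forall>x \<in> aset A (m + 1). \<forall>y \<in> aset A m.
        h m (sub A m x y) = sub A' m (h (m + 1) x) (h m y))"

definition SA :: "('a subst_alg, nat \<Rightarrow> 'a \<Rightarrow> 'a) cat" where
  "SA = \<lparr>obj = {A. substitution_algebra A}, hom = (\<lambda>A A'. {h. subst_alg_hom A A' h}),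
     idn = (\<lambda>A m. \<lambda>x\<in>aset A m. x),
     cmp = (\<lambda>A A' A'' g h m. compose (aset A m) (g m) (h m))\<rparr>"


section \<open>The functors\<close>

definition S_obj :: "'a clone \<Rightarrow> 'a subst_alg" where
  "S_obj C = \<lparr>
     psh = \<lparr>fobj = cset C,
       farr = (\<lambda>m n. \<lambda>f\<in>hom FF m n. \<lambda>t\<in>cset C m. mu C m n t (\<lambda>i\<in>{..<m}. iota C n (f i)))\<rparr>,
     sub = (\<lambda>m. \<lambda>t\<in>cset C (m + 1). \<lambda>u\<in>cset C m.
       mu C (m + 1) m t (\<lambda>i\<in>{..<m + 1}. if i < m then iota C m i else u)),
     var = (\<lambda>m. iota C (m + 1) m)\<rparr>"

definition S_func :: "('a clone, nat \<Rightarrow> 'a \<Rightarrow> 'a, 'a subst_alg, nat \<Rightarrow> 'a \<Rightarrow> 'a) func" where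
  "S_func = \<lparr>fobj = (\<lambda>C\<in>obj AC. S_obj C),
     farr = (\<lambda>C\<in>obj AC. \<lambda>C'\<in>obj AC. \<lambda>h\<in>hom AC C C'. h)\<rparr>"

text \<open>
  \<open>phi A m n t u\<close> is \<open>\<phi>\<^bsub>m,n\<^esub>(t, u\<^sub>0, \<dots>, u\<^bsub>m-1\<^esub>)\<close>; only the values of \<open>u\<close> below \<open>m\<close> are used, so
  the tuple need not be truncated in the recursive call.
\<close>

primrec phi :: "'a subst_alg \<Rightarrow> nat \<Rightarrow> nat \<Rightarrow> 'a \<Rightarrow> (nat \<Rightarrow> 'a) \<Rightarrow> 'a" where
  "phi A 0 n t u = t"
| "phi A (Suc m) n t u = phi A m n (sub A (n + m) t (act A n (n + m) (finl n) (u m))) u"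

definition C_obj :: "'a subst_alg \<Rightarrow> 'a clone" where
  "C_obj A = \<lparr>
     cset = aset A,
     mu = (\<lambda>m n. \<lambda>t\<in>aset A m. \<lambda>u\<in>{..<m} \<rightarrow>\<^sub>E aset A n. phi A m n (act A m (n + m) (finr n m) t) u),
     iota = (\<lambda>m. \<lambda>i\<in>{..<m}. act A 1 m (point i) (var A 0))\<rparr>"

definition C_func :: "('a subst_alg, nat \<Rightarrow> 'a \<Rightarrow> 'a, 'a clone, nat \<Rightarrow> 'a \<Rightarrow> 'a) func" where
  "C_func = \<lparr>fobj = (\<lambda>A\<in>obj SA. C_obj A),
     farr = (\<lambda>A\<in>obj SA. \<lambda>A'\<in>obj SA. \<lambda>h\<in>hom SA A A'. h)\<rparr>"

end

theory Submission
  imports Defs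
begin

text \<open>
  The difficulty is the associativity of the clone composition \<open>\<mu>\<close> built from single substitutions.
  By the axiom \<open>sub_sub\<close>, \<open>\<phi>\<close> distributes over a single substitution \<open>s\<close>; iterating this,
  \<open>\<phi>\<^sub>m\<close> distributes over \<open>\<phi>\<^sub>l\<close> up to the renaming that exchanges the block of \<open>m\<close> and the block
  of \<open>l\<close> substituted variables. In the instance that defines \<open>\<mu>\<close> the head term does not involve the
  \<open>m\<close> block, so the inner \<open>\<phi>\<^sub>m\<close> is vacuous on it and associativity remains. Substituting variables
  by \<open>\<phi>\<close> is a renaming, which gives the right unit law and recovers the presheaf action and \<open>s\<close>
  from \<open>\<mu>\<close>. In the other direction, \<open>\<phi>\<close> computed in a clone is the simultaneous
  substitution fixing the first \<open>n\<close> variables.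
\<close>

section \<open>The two categories\<close>

lemma PiE_UNIV_iff: "h \<in> (\<Pi>\<^sub>E X\<in>UNIV. F X) \<longleftrightarrow> (\<forall>X. h X \<in> F X)"
  by (auto simp: PiE_iff)

lemma compose_PiE: "f \<in> X \<rightarrow>\<^sub>E Y \<Longrightarrow> g \<in> Y \<rightarrow>\<^sub>E Z \<Longrightarrow> compose X g f \<in> X \<rightarrow>\<^sub>E Z"
  by (auto simp: compose_def)

lemma compose_assoc_PiE:
  "f \<in> X \<rightarrow>\<^sub>E Y \<Longrightarrow> compose X h (compose X g f) = compose X (compose Y h g) f"
  by (auto simp: compose_def fun_eq_iff)

lemma compose_id_right: "f \<in> X \<rightarrow>\<^sub>E Y \<Longrightarrow> compose X f (\<lambda>x\<in>X. x) = f"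
  by (auto simp: compose_def fun_eq_iff PiE_iff extensional_def)

lemma compose_id_left: "f \<in> X \<rightarrow>\<^sub>E Y \<Longrightarrow> compose X (\<lambda>x\<in>Y. x) f = f"
  by (auto simp: compose_def fun_eq_iff PiE_iff extensional_def)

lemma SET_simps [simp]:
  "obj SET = UNIV" "hom SET X Y = X \<rightarrow>\<^sub>E Y" "idn SET X = (\<lambda>x\<in>X. x)"
  "cmp SET X Y Z g f = compose X g f"
  by (simp_all add: SET_def)

lemma FF_simps [simp]:
  "obj FF = UNIV" "hom FF m n = {..<m} \<rightarrow>\<^sub>E {..<n}" "idn FF m = (\<lambda>i\<in>{..<m}. i)"
  "cmp FF l m n g f = compose {..<l} g f"
  by (simp_all add: FF_def)

lemma AC_simps [simp]:
  "obj AC = {C. abstract_clone C}" "hom AC C C' = {h. clone_hom C C' h}"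
  "idn AC C = (\<lambda>m. \<lambda>x\<in>cset C m. x)"
  "cmp AC C C' C'' g h = (\<lambda>m. compose (cset C m) (g m) (h m))"
  by (simp_all add: AC_def fun_eq_iff)

lemma SA_simps [simp]:
  "obj SA = {A. substitution_algebra A}" "hom SA A A' = {h. subst_alg_hom A A' h}"
  "idn SA A = (\<lambda>m. \<lambda>x\<in>aset A m. x)"
  "cmp SA A A' A'' g h = (\<lambda>m. compose (aset A m) (g m) (h m))"
  by (simp_all add: SA_def fun_eq_iff)

lemma nat_trans_FF_SET:
  "nat_trans FF SET F G h \<longleftrightarrow> (\<forall>m. h m \<in> fobj F m \<rightarrow>\<^sub>E fobj G m) \<and>
     (\<forall>m n. \<forall>f\<in>hom FF m n.
        compose (fobj F m) (h n) (farr F m n f) = compose (fobj F m) (farr G m n f) (h m))"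
  unfolding nat_trans_def by (simp add: PiE_UNIV_iff)

section \<open>Clone homomorphisms and their category\<close>

lemma (in abstract_clone) mu_in:
  "x \<in> cset C m \<Longrightarrow> y \<in> {..<m} \<rightarrow>\<^sub>E cset C n \<Longrightarrow> mu C m n x y \<in> cset C n"
  using mu_type[of m n] by (metis PiE_mem)

lemma (in abstract_clone) iota_in: "i < m \<Longrightarrow> iota C m i \<in> cset C m"
  using iota_type[of m] by (metis PiE_mem lessThan_iff)

lemma clone_homI:
  assumes "\<And>m. h m \<in> cset C m \<rightarrow>\<^sub>E cset C' m"
    and "\<And>m n x y. x \<in> cset C m \<Longrightarrow> y \<in> {..<m} \<rightarrow>\<^sub>E cset C n \<Longrightarrow>
      h n (mu C m n x y) = mu C' m n (h m x) (\<lambda>j\<in>{..<m}. h n (y j))"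
    and "\<And>m i. i < m \<Longrightarrow> h m (iota C m i) = iota C' m i"
  shows "clone_hom C C' h"
  unfolding clone_hom_def using assms by blast

lemma clone_homD:
  assumes "clone_hom C C' h"
  shows "h m \<in> cset C m \<rightarrow>\<^sub>E cset C' m"
    and "x \<in> cset C m \<Longrightarrow> h m x \<in> cset C' m"
    and "x \<in> cset C m \<Longrightarrow> y \<in> {..<m} \<rightarrow>\<^sub>E cset C n \<Longrightarrow>
      h n (mu C m n x y) = mu C' m n (h m x) (\<lambda>j\<in>{..<m}. h n (y j))"
    and "i < m \<Longrightarrow> h m (iota C m i) = iota C' m i"
proof -
  show "h m \<in> cset C m \<rightarrow>\<^sub>E cset C' m"
    using assms unfolding clone_hom_def by blast
  then show "x \<in> cset C m \<Longrightarrow> h m x \<in> cset C' m"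
    by blast
  show "x \<in> cset C m \<Longrightarrow> y \<in> {..<m} \<rightarrow>\<^sub>E cset C n \<Longrightarrow>
      h n (mu C m n x y) = mu C' m n (h m x) (\<lambda>j\<in>{..<m}. h n (y j))"
    and "i < m \<Longrightarrow> h m (iota C m i) = iota C' m i"
    using assms unfolding clone_hom_def by blast+
qed

lemma clone_hom_id:
  assumes "abstract_clone C"
  shows "clone_hom C C (\<lambda>m. \<lambda>x\<in>cset C m. x)"
proof -
  interpret abstract_clone C by fact
  show ?thesis
  proof (rule clone_homI)
    fix m n x y
    assume x: "x \<in> cset C m" and y: "y \<in> {..<m} \<rightarrow>\<^sub>E cset C n"
    have "(\<lambda>j\<in>{..<m}. (\<lambda>x\<in>cset C n. x) (y j)) = y"
      using y by (auto simp: fun_eq_iff PiE_iff extensional_def)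
    then show "(\<lambda>x\<in>cset C n. x) (mu C m n x y)
        = mu C m n ((\<lambda>x\<in>cset C m. x) x) (\<lambda>j\<in>{..<m}. (\<lambda>x\<in>cset C n. x) (y j))"
      using x y by (simp add: mu_in)
  qed (simp_all add: iota_in)
qed

lemma clone_hom_compose:
  assumes C: "abstract_clone C" and h: "clone_hom C C' h" and g: "clone_hom C' C'' g"
  shows "clone_hom C C'' (\<lambda>m. compose (cset C m) (g m) (h m))"
proof -
  interpret abstract_clone C by fact
  show ?thesis
  proof (rule clone_homI)
    show "compose (cset C m) (g m) (h m) \<in> cset C m \<rightarrow>\<^sub>E cset C'' m" for m
      using compose_PiE clone_homD(1)[OF h] clone_homD(1)[OF g] .
  next
    fix m n x y
    assume x: "x \<in> cset C m" and y: "y \<in> {..<m} \<rightarrow>\<^sub>E cset C n"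
    have y': "(\<lambda>j\<in>{..<m}. h n (y j)) \<in> {..<m} \<rightarrow>\<^sub>E cset C' n"
      using y by (auto intro: clone_homD(2)[OF h])
    have "(\<lambda>j\<in>{..<m}. g n ((\<lambda>j\<in>{..<m}. h n (y j)) j))
        = (\<lambda>j\<in>{..<m}. compose (cset C n) (g n) (h n) (y j))"
      using y by (intro restrict_ext) (simp add: compose_def PiE_iff)
    then show "compose (cset C n) (g n) (h n) (mu C m n x y) = mu C'' m n
        (compose (cset C m) (g m) (h m) x) (\<lambda>j\<in>{..<m}. compose (cset C n) (g n) (h n) (y j))"
      using x y y'
      by (simp add: compose_eq mu_in clone_homD(3)[OF h] clone_homD(2)[OF h] clone_homD(3)[OF g])
  qed (simp add: compose_eq iota_in clone_homD(4)[OF h] clone_homD(4)[OF g])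
qed

text \<open>The laws are checked in each degree: the unit laws rely on the components being
  extensional, associativity on their landing in the next carrier.\<close>

lemma category_AC: "category AC"
  by (unfold_locales; unfold AC_simps mem_Collect_eq)
    (erule clone_hom_id
      | erule clone_hom_compose, assumption, assumption
      | rule ext, erule clone_homD(1)[THEN compose_id_right]
      | rule ext, erule clone_homD(1)[THEN compose_id_left]
      | rule ext, erule clone_homD(1)[THEN compose_assoc_PiE])+

section \<open>Homomorphisms of substitution algebras, elementwise\<close>

lemma subst_alg_homI:
  assumes "\<And>m. h m \<in> aset A m \<rightarrow>\<^sub>E aset A' m"
    and "\<And>m n f x. f \<in> hom FF m n \<Longrightarrow> x \<in> aset A m \<Longrightarrow>
      h n (act A m n f x) = act A' m n f (h m x)"
    and "\<And>m. h (m + 1) (var A m) = var A' m"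
    and "\<And>m x y. x \<in> aset A (m + 1) \<Longrightarrow> y \<in> aset A m \<Longrightarrow>
      h m (sub A m x y) = sub A' m (h (m + 1) x) (h m y)"
  shows "subst_alg_hom A A' h"
  unfolding subst_alg_hom_def nat_trans_FF_SET using assms
  by (auto simp: compose_def intro!: restrict_ext)

lemma subst_alg_homD:
  assumes h: "subst_alg_hom A A' h"
  shows "h m \<in> aset A m \<rightarrow>\<^sub>E aset A' m"
    and "x \<in> aset A m \<Longrightarrow> h m x \<in> aset A' m"
    and "f \<in> hom FF m n \<Longrightarrow> x \<in> aset A m \<Longrightarrow> h n (act A m n f x) = act A' m n f (h m x)"
    and "h (m + 1) (var A m) = var A' m"
    and "x \<in> aset A (m + 1) \<Longrightarrow> y \<in> aset A m \<Longrightarrow>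
      h m (sub A m x y) = sub A' m (h (m + 1) x) (h m y)"
proof -
  have type: "\<forall>m. h m \<in> aset A m \<rightarrow>\<^sub>E aset A' m"
    and nat: "\<forall>m n. \<forall>f\<in>hom FF m n.
      compose (aset A m) (h n) (act A m n f) = compose (aset A m) (act A' m n f) (h m)"
    and var: "\<forall>m. h (m + 1) (var A m) = var A' m"
    and sub: "\<forall>m. \<forall>x\<in>aset A (m + 1). \<forall>y\<in>aset A m.
      h m (sub A m x y) = sub A' m (h (m + 1) x) (h m y)"
    using h unfolding subst_alg_hom_def nat_trans_FF_SET by simp_all
  show "h m \<in> aset A m \<rightarrow>\<^sub>E aset A' m"
    using type by (rule spec)
  then show "x \<in> aset A m \<Longrightarrow> h m x \<in> aset A' m"
    by (rule PiE_mem)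
  show "h n (act A m n f x) = act A' m n f (h m x)" if "f \<in> hom FF m n" "x \<in> aset A m"
    using fun_cong[OF bspec[OF spec[OF spec[OF nat]] that(1)], of x] that(2)
    by (simp only: compose_eq)
  show "h (m + 1) (var A m) = var A' m"
    using var by (rule spec)
  show "h m (sub A m x y) = sub A' m (h (m + 1) x) (h m y)"
    if "x \<in> aset A (m + 1)" "y \<in> aset A m"
    using sub that by simp
qed

section \<open>From substitution algebras to abstract clones\<close>

text \<open>Renamings are extended to arbitrary functions on \<open>nat\<close>, of which only the values below \<open>m\<close>
  matter; equations between composites of renamings then become pointwise arithmetic.\<close>

definition ren :: "'a subst_alg \<Rightarrow> nat \<Rightarrow> nat \<Rightarrow> (nat \<Rightarrow> nat) \<Rightarrow> 'a \<Rightarrow> 'a" where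
  "ren A m n f = act A m n (restrict f {..<m})"

section \<open>Renamings, variables and single substitution\<close>

context substitution_algebra
begin

sublocale psh: cat_functor FF SET "psh A"
  by (rule psh_functor)

lemma act_type: "f \<in> {..<m} \<rightarrow>\<^sub>E {..<n} \<Longrightarrow> act A m n f \<in> aset A m \<rightarrow>\<^sub>E aset A n"
  using psh.farr_type by (simp add: PiE_UNIV_iff) (metis PiE_mem)

lemma act_in: "f \<in> hom FF m n \<Longrightarrow> x \<in> aset A m \<Longrightarrow> act A m n f x \<in> aset A n"
  by (rule PiE_mem[OF act_type]) simp_all

lemma restrict_hom: "(\<And>i. i < m \<Longrightarrow> f i < n) \<Longrightarrow> restrict f {..<m} \<in> {..<m} \<rightarrow>\<^sub>E {..<n}"
  by auto

lemma ren_in: "(\<And>i. i < m \<Longrightarrow> f i < n) \<Longrightarrow> x \<in> aset A m \<Longrightarrow> ren A m n f x \<in> aset A n"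
  unfolding ren_def using act_type[OF restrict_hom] by (metis PiE_mem)

lemma ren_cong: "(\<And>i. i < m \<Longrightarrow> f i = g i) \<Longrightarrow> ren A m n f x = ren A m n g x"
  unfolding ren_def by (metis lessThan_iff restrict_ext)

lemma act_eq_ren: "f \<in> {..<m} \<rightarrow>\<^sub>E {..<n} \<Longrightarrow> act A m n f x = ren A m n f x"
  unfolding ren_def by (simp add: PiE_restrict)

lemma ren_id: "x \<in> aset A m \<Longrightarrow> (\<And>i. i < m \<Longrightarrow> f i = i) \<Longrightarrow> ren A m m f x = x"
  using psh.farr_idn[of m] ren_cong[of m f "\<lambda>i. i" m x] by (simp add: ren_def)

lemma ren_ren:
  assumes f: "\<And>i. i < l \<Longrightarrow> f i < m" and g: "\<And>i. i < m \<Longrightarrow> g i < n" and x: "x \<in> aset A l"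
  shows "ren A m n g (ren A l m f x) = ren A l n (\<lambda>i. g (f i)) x"
proof -
  have "compose {..<l} (restrict g {..<m}) (restrict f {..<l}) = (\<lambda>i\<in>{..<l}. g (f i))"
    using f by (auto simp: compose_def)
  then show ?thesis
    using psh.farr_cmp[of l m n "restrict f {..<l}" "restrict g {..<m}"] f g x
    by (simp add: ren_def compose_eq Pi_iff)
qed

lemma sub_in: "x \<in> aset A (Suc m) \<Longrightarrow> y \<in> aset A m \<Longrightarrow> sub A m x y \<in> aset A m"
  using sub_type[of m] by (metis PiE_mem Suc_eq_plus1)

lemma var_in: "var A m \<in> aset A (Suc m)"
  using var_type[of m] by simp

lemma ren_sub:
  assumes f: "\<And>i. i < m \<Longrightarrow> f i < n" and x: "x \<in> aset A (Suc m)" and y: "y \<in> aset A m"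
  shows "ren A m n f (sub A m x y)
    = sub A n (ren A (Suc m) (Suc n) (\<lambda>i. if i < m then f i else n) x) (ren A m n f y)"
proof -
  have "fplus m 1 n (restrict f {..<m}) (idn FF 1)
      = restrict (\<lambda>i. if i < m then f i else n) {..<Suc m}"
    by (auto simp: fplus_def fun_eq_iff)
  then show ?thesis
    using sub_natural[of "restrict f {..<m}" m n x y] f x y by (simp add: ren_def Pi_iff)
qed

text \<open>The clone variable of index \<open>i\<close> in context \<open>m\<close>, left
  untruncated in \<open>i\<close>.\<close>

definition vr :: "nat \<Rightarrow> nat \<Rightarrow> 'a" where
  "vr m i = ren A 1 m (\<lambda>_. i) (var A 0)"

lemma vr_in: "i < m \<Longrightarrow> vr m i \<in> aset A m"
  using ren_in[of 1 "\<lambda>_. i"] var_in[of 0] by (simp add: vr_def)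

lemma ren_vr: "i < m \<Longrightarrow> (\<And>i. i < m \<Longrightarrow> f i < n) \<Longrightarrow> ren A m n f (vr m i) = vr n (f i)"
  using var_in[of 0] by (simp add: vr_def ren_ren)

lemma vr_last: "vr (Suc m) m = var A m"
proof -
  \<comment> \<open>\<open>\<lambda>_. undefined\<close> is the empty map, the only element of
    \<open>hom FF 0 m\<close>; naturality along it carries \<open>var A 0\<close> to
    \<open>var A m\<close>.\<close>
  have "fplus 0 1 m (\<lambda>_. undefined) (idn FF 1) = (\<lambda>_\<in>{..<1}. m)"
    by (auto simp: fplus_def fun_eq_iff)
  then have "act A (0 + 1) (m + 1) (\<lambda>_\<in>{..<1}. m) (var A 0) = var A m"
    using var_natural[of "\<lambda>_. undefined" 0 m] by simp
  then show ?thesis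
    by (simp add: vr_def ren_def)
qed

lemma sub_vr_last: "x \<in> aset A m \<Longrightarrow> sub A m (vr (Suc m) m) x = x"
  by (simp add: vr_last sub_var_left)

text \<open>Here and in the next two lemmas axioms are put in terms of \<open>ren\<close>:
  \<open>id + weak\<close> is an inclusion, \<open>id + swap2\<close> transposes the last two
  indices, \<open>id + contr\<close> merges them.\<close>

lemma sub_ren_weak:
  assumes "x \<in> aset A m" and y: "y \<in> aset A m"
  shows "sub A m (ren A m (Suc m) (\<lambda>i. i) x) y = x"
proof -
  have "fplus m 0 m (idn FF m) weak = restrict (\<lambda>i. i) {..<m}"
    by (auto simp: fplus_def fun_eq_iff)
  then show ?thesis
    using sub_weak[OF assms] by (simp add: ren_def)
qed

lemma sub_sub_ren:
  assumes "x \<in> aset A (Suc (Suc m))" and "y \<in> aset A (Suc m)" and "z \<in> aset A m"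
  shows "sub A m (sub A (Suc m) x y) z = sub A m
    (sub A (Suc m)
      (ren A (Suc (Suc m)) (Suc (Suc m)) (\<lambda>i. if i < m then i else if i = m then Suc m else m) x)
      (ren A m (Suc m) (\<lambda>i. i) z))
    (sub A m y z)"
proof -
  have 1: "fplus m 0 m (idn FF m) weak = restrict (\<lambda>i. i) {..<m}"
    by (auto simp: fplus_def fun_eq_iff)
  have 2: "fplus m 2 m (idn FF m) swap2
      = restrict (\<lambda>i. if i < m then i else if i = m then Suc m else m) {..<Suc (Suc m)}"
    by (auto simp: fplus_def swap2_def fun_eq_iff)
  show ?thesis
    using sub_sub[of x m y z] assms unfolding 1 2 by (simp add: ren_def)
qed

lemma sub_vr_contr:
  assumes x: "x \<in> aset A (Suc (Suc m))"
  shows "sub A (Suc m) x (vr (Suc m) m)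
    = ren A (Suc (Suc m)) (Suc m) (\<lambda>j. if j < m then j else m) x"
proof -
  have c: "fplus m 2 m (idn FF m) contr
      = restrict (\<lambda>j. if j < m then j else m) {..<Suc (Suc m)}"
    by (auto simp: fplus_def contr_def fun_eq_iff)
  show ?thesis
    using sub_var_right[of x m] x unfolding c vr_last ren_def by simp
qed

text \<open>The axiom \<open>sub_var_right\<close> inserts the variable \<open>m\<close> in context
  \<open>m + 1\<close>. A general variable \<open>i\<close> is reached by inserting a fresh
  \<open>m\<close> and renaming it to \<open>i\<close> afterwards; naturality moves that renaming
  inside.\<close>

lemma sub_vr:
  assumes x: "x \<in> aset A (Suc m)" and i: "i < m"
  shows "sub A m x (vr m i) = ren A (Suc m) m (\<lambda>j. if j < m then j else i) x"
proof -
  \<comment> \<open>\<open>g\<close> moves the bound variable from \<open>m\<close> to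
    \<open>m + 1\<close> and so leaves \<open>m\<close> fresh, \<open>c\<close> is the contraction
    merging the two, and \<open>f\<close> identifies \<open>m\<close> with \<open>i\<close>.\<close>
  define f where "f j = (if j < m then j else i)" for j
  define g where "g j = (if j < m then j else Suc m)" for j
  define c where "c j = (if j < m then j else m)" for j
  define y where "y = ren A (Suc m) (Suc (Suc m)) g x"
  have f: "f j < m" and g: "j < Suc m \<Longrightarrow> g j < Suc (Suc m)" and c: "c j < Suc m" for j
    using i by (auto simp: f_def g_def c_def)
  have y: "y \<in> aset A (Suc (Suc m))"
    unfolding y_def using g x by (rule ren_in)
  have "sub A m x (vr m i) = ren A (Suc m) m f (sub A (Suc m) y (vr (Suc m) m))"
  proof -
    \<comment> \<open>Renaming by \<open>f + id\<close> undoes \<open>g\<close>: the bound variable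
      returns from \<open>m + 1\<close> to \<open>m\<close>.\<close>
    have "ren A (Suc (Suc m)) (Suc m) (\<lambda>j. if j < Suc m then f j else m) y
        = ren A (Suc m) (Suc m) (\<lambda>j. if g j < Suc m then f (g j) else m) x"
      unfolding y_def using f g x by (subst ren_ren) (auto simp: less_SucI)
    also have "\<dots> = x"
      using x by (rule ren_id) (auto simp: f_def g_def)
    moreover have "ren A (Suc m) m f (vr (Suc m) m) = vr m i"
      using f ren_vr[of m "Suc m" f m] by (simp add: f_def[abs_def])
    ultimately show ?thesis
      using ren_sub[of "Suc m" f m y "vr (Suc m) m"] f y vr_in[of m "Suc m"] by simp
  qed
  also have "\<dots> = ren A (Suc m) m f (ren A (Suc (Suc m)) (Suc m) c y)"
    using sub_vr_contr[OF y] by (simp add: c_def[abs_def])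
  also have "\<dots> = ren A (Suc (Suc m)) m (\<lambda>j. f (c j)) y"
    using c f y by (rule ren_ren)
  also have "\<dots> = ren A (Suc m) m (\<lambda>j. f (c (g j))) x"
    unfolding y_def using g f x by (rule ren_ren)
  also have "\<dots> = ren A (Suc m) m f x"
    by (rule ren_cong) (auto simp: f_def g_def c_def)
  finally show ?thesis
    by (simp add: f_def[abs_def])
qed

section \<open>Elementary properties of iterated substitution\<close>

text \<open>This is \<open>f + id\<close> for added blocks of every size at once.\<close>

definition extend :: "nat \<Rightarrow> nat \<Rightarrow> (nat \<Rightarrow> nat) \<Rightarrow> nat \<Rightarrow> nat" where
  "extend n n' f i = (if i < n then f i else n' + (i - n))"

lemma extend_less: "(\<And>i. i < n \<Longrightarrow> f i < n') \<Longrightarrow> i < n + m \<Longrightarrow> extend n n' f i < n' + m"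
  by (fastforce simp: extend_def)

lemma phi_Suc:
  "phi A (Suc m) n t u = phi A m n (sub A (n + m) t (ren A n (n + m) (\<lambda>i. i) (u m))) u"
  by (simp add: ren_def finl_def)

declare phi.simps(2) [simp del]

lemma phi_in:
  "t \<in> aset A (n + m) \<Longrightarrow> (\<And>i. i < m \<Longrightarrow> u i \<in> aset A n) \<Longrightarrow> phi A m n t u \<in> aset A n"
proof (induction m arbitrary: t)
  case (Suc m)
  then have "sub A (n + m) t (ren A n (n + m) (\<lambda>i. i) (u m)) \<in> aset A (n + m)"
    by (intro sub_in ren_in) auto
  with Suc show ?case by (simp add: phi_Suc)
qed simp

lemma phi_cong: "(\<And>i. i < m \<Longrightarrow> u i = u' i) \<Longrightarrow> phi A m n t u = phi A m n t u'"
  by (induction m arbitrary: t) (simp_all add: phi_Suc)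

text \<open>Naturality of each single substitution lets a renaming of the free variables pass
  through; the substituted variables are carried along as a block.\<close>

lemma ren_phi:
  assumes f: "\<And>i. i < n \<Longrightarrow> f i < n'"
  shows "t \<in> aset A (n + m) \<Longrightarrow> (\<And>i. i < m \<Longrightarrow> u i \<in> aset A n) \<Longrightarrow>
    ren A n n' f (phi A m n t u)
      = phi A m n' (ren A (n + m) (n' + m) (extend n n' f) t) (\<lambda>i. ren A n n' f (u i))"
proof (induction m arbitrary: t)
  case 0
  then show ?case by (auto simp: extend_def intro: ren_cong)
next
  case (Suc m)
  have t: "t \<in> aset A (Suc (n + m))" and um: "u m \<in> aset A n"
    using Suc.prems by auto
  have um': "ren A n (n + m) (\<lambda>i. i) (u m) \<in> aset A (n + m)"
    using um by (auto intro: ren_in)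
  have "ren A (n + m) (n' + m) (extend n n' f) (sub A (n + m) t (ren A n (n + m) (\<lambda>i. i) (u m)))
      = sub A (n' + m)
          (ren A (Suc (n + m)) (Suc (n' + m)) (\<lambda>i. if i < n + m then extend n n' f i else n' + m) t)
          (ren A (n + m) (n' + m) (extend n n' f) (ren A n (n + m) (\<lambda>i. i) (u m)))"
    using extend_less[OF f] t um' by (rule ren_sub)
  also have "ren A (Suc (n + m)) (Suc (n' + m)) (\<lambda>i. if i < n + m then extend n n' f i else n' + m) t
      = ren A (Suc (n + m)) (Suc (n' + m)) (extend n n' f) t"
    by (rule ren_cong) (auto simp: extend_def)
  \<comment> \<open>\<open>u m\<close> uses only indices below \<open>n\<close>, where
    \<open>extend n n' f\<close> is \<open>f\<close>; so weakening and renaming commute.\<close>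
  also have "ren A (n + m) (n' + m) (extend n n' f) (ren A n (n + m) (\<lambda>i. i) (u m))
      = ren A n (n' + m) (\<lambda>i. extend n n' f i) (u m)"
    using extend_less[OF f] um by (intro ren_ren) auto
  also have "\<dots> = ren A n (n' + m) f (u m)"
    by (rule ren_cong) (simp add: extend_def)
  also have "\<dots> = ren A n' (n' + m) (\<lambda>i. i) (ren A n n' f (u m))"
    using f um by (intro ren_ren[symmetric]) auto
  finally show ?case
    using Suc t um' by (simp add: phi_Suc sub_in)
qed

text \<open>The inclusion of \<open>n\<close> into \<open>n + m + 1\<close> factors through
  \<open>n + m\<close>, so the first substitution acts on a weakened term and cancels.\<close>

lemma phi_weak:
  "x \<in> aset A n \<Longrightarrow> (\<And>i. i < m \<Longrightarrow> u i \<in> aset A n) \<Longrightarrow>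
    phi A m n (ren A n (n + m) (\<lambda>i. i) x) u = x"
proof (induction m)
  case 0
  then show ?case by (simp add: ren_id)
next
  case (Suc m)
  have "ren A n (Suc (n + m)) (\<lambda>i. i) x
      = ren A (n + m) (Suc (n + m)) (\<lambda>i. i) (ren A n (n + m) (\<lambda>i. i) x)"
    using Suc.prems by (intro ren_ren[symmetric]) auto
  then show ?case
    using Suc by (simp add: phi_Suc sub_ren_weak ren_in)
qed

text \<open>\<open>phi\<close> eliminates variables from the top. For \<open>i = m\<close> the first
  step yields the weakened \<open>u m\<close>, which the rest leaves alone by
  \<open>phi_weak\<close>; for \<open>i < m\<close> the first step acts on a weakened
  variable.\<close>

lemma phi_vr:
  "i < m \<Longrightarrow> (\<And>i. i < m \<Longrightarrow> u i \<in> aset A n) \<Longrightarrow> phi A m n (vr (n + m) (n + i)) u = u i"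
proof (induction m)
  case (Suc m)
  have um: "ren A n (n + m) (\<lambda>i. i) (u m) \<in> aset A (n + m)"
    using Suc.prems by (auto intro: ren_in)
  show ?case
  proof (cases "i = m")
    case True
    then show ?thesis
      using Suc.prems um by (simp add: phi_Suc sub_vr_last phi_weak)
  next
    case False
    then have "vr (Suc (n + m)) (n + i) = ren A (n + m) (Suc (n + m)) (\<lambda>i. i) (vr (n + m) (n + i))"
      using Suc.prems by (subst ren_vr) auto
    then show ?thesis
      using False Suc um by (simp add: phi_Suc sub_ren_weak vr_in)
  qed
qed simp

text \<open>By \<open>sub_vr\<close> each step contracts the top variable onto a lower one; the
  contractions compose to one renaming.\<close>

lemma phi_ren:
  assumes f: "\<And>i. i < m \<Longrightarrow> f i < n" and t: "t \<in> aset A (n + m)"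
  shows "phi A m n t (\<lambda>i. vr n (f i)) = ren A (n + m) n (\<lambda>i. if i < n then i else f (i - n)) t"
  using assms
proof (induction m arbitrary: t)
  case 0
  then show ?case by (simp add: ren_id)
next
  case (Suc m)
  let ?g = "\<lambda>i. if i < n then i else f (i - n)"
  have fm: "f m < n" "f m < n + m" and t: "t \<in> aset A (Suc (n + m))"
    using Suc.prems(1)[of m] Suc.prems(2) by auto
  have "sub A (n + m) t (ren A n (n + m) (\<lambda>i. i) (vr n (f m)))
      = ren A (Suc (n + m)) (n + m) (\<lambda>j. if j < n + m then j else f m) t"
    using fm t by (subst ren_vr; (subst sub_vr)?) auto
  moreover have "ren A (Suc (n + m)) (n + m) (\<lambda>j. if j < n + m then j else f m) t \<in> aset A (n + m)"
    using fm t by (intro ren_in) auto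
  moreover have "ren A (n + m) n ?g
      (ren A (Suc (n + m)) (n + m) (\<lambda>j. if j < n + m then j else f m) t)
    = ren A (Suc (n + m)) n (\<lambda>j. ?g (if j < n + m then j else f m)) t"
    using Suc.prems(1) fm t by (intro ren_ren) auto
  \<comment> \<open>The top index goes to \<open>f m\<close>, which the outer renaming fixes because
    \<open>f m < n\<close>.\<close>
  moreover have "\<dots> = ren A (Suc (n + m)) n ?g t"
    using fm by (intro ren_cong) (auto simp: not_less less_Suc_eq)
  ultimately show ?case
    using Suc by (simp add: phi_Suc)
qed

section \<open>Distributivity of \<open>phi\<close> over \<open>sub\<close> and over itself\<close>

text \<open>\<open>rot\<close> moves the variable bound by \<open>sub\<close> below those
  that are to be substituted.\<close>

definition rot :: "nat \<Rightarrow> nat \<Rightarrow> nat \<Rightarrow> nat" where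
  "rot n m i = (if i < n then i else if i < n + m then Suc i else n)"

lemma rot_less: "i < Suc (n + m) \<Longrightarrow> rot n m i < Suc (n + m)"
  by (auto simp: rot_def)

text \<open>Each use of \<open>sub_sub\<close> exchanges the next substituted variable with the one
  bound by \<open>sub\<close>. After \<open>m\<close> exchanges the bound variable has index
  \<open>n\<close>; hence \<open>rot\<close> on \<open>x\<close>, the context \<open>n + 1\<close>
  and the weakened tuple.\<close>

lemma phi_sub:
  "x \<in> aset A (Suc (n + m)) \<Longrightarrow> y \<in> aset A (n + m) \<Longrightarrow> (\<And>i. i < m \<Longrightarrow> u i \<in> aset A n) \<Longrightarrow>
    phi A m n (sub A (n + m) x y) u = sub A n
      (phi A m (Suc n) (ren A (Suc (n + m)) (Suc (n + m)) (rot n m) x)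
        (\<lambda>i. ren A n (Suc n) (\<lambda>i. i) (u i)))
      (phi A m n y u)"
proof (induction m arbitrary: x y)
  case 0
  then show ?case by (simp add: ren_id rot_def)
next
  case (Suc m)
  let ?N = "n + m"
  let ?swap = "\<lambda>i. if i < ?N then i else if i = ?N then Suc ?N else ?N"
  let ?z = "ren A n ?N (\<lambda>i. i) (u m)"
  let ?x = "ren A (Suc (Suc ?N)) (Suc (Suc ?N)) ?swap x"
  let ?wz = "ren A n (Suc ?N) (\<lambda>i. i) (u m)"
  let ?rx = "ren A (Suc (Suc ?N)) (Suc (Suc ?N)) (rot n (Suc m)) x"
  have x: "x \<in> aset A (Suc (Suc ?N))" and y: "y \<in> aset A (Suc ?N)" and um: "u m \<in> aset A n"
    using Suc.prems by auto
  have z: "?z \<in> aset A ?N" and wz: "?wz \<in> aset A (Suc ?N)"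
    using um by (auto intro: ren_in)
  have x': "?x \<in> aset A (Suc (Suc ?N))"
    using x by (auto intro: ren_in)
  have wz_eq: "ren A ?N (Suc ?N) (\<lambda>i. i) ?z = ?wz"
    using um by (intro ren_ren) auto
  \<comment> \<open>The recursion of \<open>rot\<close>: transposing the top two indices and then
    applying \<open>rot n m + id\<close> is \<open>rot n (m + 1)\<close>.\<close>
  have "ren A (Suc (Suc ?N)) (Suc (Suc ?N)) (\<lambda>i. if i < Suc ?N then rot n m i else Suc ?N) ?x
      = ren A (Suc (Suc ?N)) (Suc (Suc ?N))
          (\<lambda>i. if ?swap i < Suc ?N then rot n m (?swap i) else Suc ?N) x"
    using x rot_less by (intro ren_ren) (auto intro: less_SucI)
  also have "\<dots> = ?rx"
    by (rule ren_cong) (auto simp: rot_def)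
  finally have rx: "ren A (Suc (Suc ?N)) (Suc (Suc ?N))
      (\<lambda>i. if i < Suc ?N then rot n m i else Suc ?N) ?x = ?rx" .
  \<comment> \<open>\<open>rot n m\<close> fixes the indices below \<open>n\<close>, so the weakened
    \<open>u m\<close> avoids the bound variable, now at index \<open>n\<close>.\<close>
  have "ren A (Suc ?N) (Suc ?N) (rot n m) ?wz = ren A n (Suc ?N) (\<lambda>i. rot n m i) (u m)"
    using rot_less um by (intro ren_ren) auto
  also have "\<dots> = ren A n (Suc ?N) (\<lambda>i. i) (u m)"
    by (rule ren_cong) (simp add: rot_def)
  also have "\<dots> = ren A (Suc n) (Suc ?N) (\<lambda>i. i) (ren A n (Suc n) (\<lambda>i. i) (u m))"
    using um by (intro ren_ren[symmetric]) auto
  finally have *: "ren A (Suc ?N) (Suc ?N) (rot n m) (sub A (Suc ?N) ?x ?wz)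
      = sub A (Suc n + m) ?rx
          (ren A (Suc n) (Suc n + m) (\<lambda>i. i) (ren A n (Suc n) (\<lambda>i. i) (u m)))"
    using ren_sub[OF rot_less x' wz] rx by simp
  \<comment> \<open>The top substitution is unfolded and \<open>sub_sub\<close> pushes it into both
    arguments; the induction hypothesis treats the remaining \<open>m\<close>.\<close>
  have "phi A (Suc m) n (sub A (n + Suc m) x y) u
      = phi A m n (sub A ?N (sub A (Suc ?N) ?x ?wz) (sub A ?N y ?z)) u"
    using sub_sub_ren[OF x y z] by (simp add: phi_Suc wz_eq)
  also have "\<dots> = sub A n
      (phi A m (Suc n) (ren A (Suc ?N) (Suc ?N) (rot n m) (sub A (Suc ?N) ?x ?wz))
        (\<lambda>i. ren A n (Suc n) (\<lambda>i. i) (u i)))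
      (phi A m n (sub A ?N y ?z) u)"
    using Suc.prems(3) x' wz y z by (intro Suc.IH sub_in) auto
  also have "\<dots> = sub A n
      (phi A (Suc m) (Suc n) ?rx (\<lambda>i. ren A n (Suc n) (\<lambda>i. i) (u i)))
      (phi A (Suc m) n y u)"
    unfolding * by (simp add: phi_Suc)
  finally show ?case by simp
qed

text \<open>The coproduct symmetry from \<open>m + l\<close> to \<open>l + m\<close> beside a fixed
  \<open>n\<close>; in the last branch \<open>i\<close> is at least \<open>n + m\<close>, so the
  subtraction is exact.\<close>

definition swap_blocks :: "nat \<Rightarrow> nat \<Rightarrow> nat \<Rightarrow> nat \<Rightarrow> nat" where
  "swap_blocks n m l i = (if i < n then i else if i < n + m then i + l else i - m)"

lemma swap_blocks_less: "i < n + m + l \<Longrightarrow> swap_blocks n m l i < n + l + m"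
  by (auto simp: swap_blocks_def)

text \<open>The induction step works because \<open>swap_blocks n m (l + 1)\<close> is \<open>swap_blocks n m l + id\<^sub>1\<close>
  followed by \<open>rot (n + l) m\<close>.\<close>

lemma phi_phi:
  assumes z: "\<And>k. k < m \<Longrightarrow> z k \<in> aset A n"
  shows "t \<in> aset A (n + m + l) \<Longrightarrow> (\<And>j. j < l \<Longrightarrow> y j \<in> aset A (n + m)) \<Longrightarrow>
    phi A m n (phi A l (n + m) t y) z = phi A l n
      (phi A m (n + l) (ren A (n + m + l) (n + l + m) (swap_blocks n m l) t)
        (\<lambda>k. ren A n (n + l) (\<lambda>i. i) (z k)))
      (\<lambda>j. phi A m n (y j) z)"
proof (induction l arbitrary: t)
  case 0
  have "phi A m n t (\<lambda>k. ren A n n (\<lambda>i. i) (z k)) = phi A m n t z"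
    using z by (intro phi_cong ren_id refl)
  moreover have "ren A (n + m) (n + m) (swap_blocks n m 0) t = t"
    using 0 by (intro ren_id) (auto simp: swap_blocks_def)
  ultimately show ?case by simp
next
  case (Suc l)
  let ?y = "ren A (n + m) (n + m + l) (\<lambda>i. i) (y l)"
  let ?z = "\<lambda>k. ren A n (n + l) (\<lambda>i. i) (z k)"
  let ?t = "ren A (Suc (n + m + l)) (Suc (n + l + m))
    (\<lambda>i. if i < n + m + l then swap_blocks n m l i else n + l + m) t"
  have t: "t \<in> aset A (Suc (n + m + l))" and yl: "y l \<in> aset A (n + m)"
    using Suc.prems by auto
  have y: "?y \<in> aset A (n + m + l)"
    using yl by (auto intro: ren_in)
  have t': "?t \<in> aset A (Suc (n + l + m))"
    using t by (rule ren_in[rotated]) (auto intro: less_SucI swap_blocks_less)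
  have z': "?z k \<in> aset A (n + l)" if "k < m" for k
    using z[OF that] by (auto intro: ren_in)
  have sw_y: "ren A (n + m + l) (n + l + m) (swap_blocks n m l) ?y
      = ren A (n + m) (n + l + m) (\<lambda>i. swap_blocks n m l i) (y l)"
    using yl swap_blocks_less by (intro ren_ren) auto
  have sw_y_in: "ren A (n + m + l) (n + l + m) (swap_blocks n m l) ?y \<in> aset A (n + l + m)"
    using swap_blocks_less y by (rule ren_in)
  have "phi A m (n + l) (ren A (n + m + l) (n + l + m) (swap_blocks n m l) (sub A (n + m + l) t ?y)) ?z
      = phi A m (n + l) (sub A (n + l + m) ?t
          (ren A (n + m + l) (n + l + m) (swap_blocks n m l) ?y)) ?z"
    using ren_sub[OF swap_blocks_less t y] by simp
  \<comment> \<open>The \<open>l\<close> variables not yet eliminated are free here, so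
    \<open>phi_sub\<close> is used in context \<open>n + l\<close>.\<close>
  also have "\<dots> = sub A (n + l)
      (phi A m (Suc (n + l)) (ren A (Suc (n + l + m)) (Suc (n + l + m)) (rot (n + l) m) ?t)
        (\<lambda>k. ren A (n + l) (Suc (n + l)) (\<lambda>i. i) (?z k)))
      (phi A m (n + l) (ren A (n + m + l) (n + l + m) (swap_blocks n m l) ?y) ?z)"
    using t' sw_y_in z' by (rule phi_sub)
  also have "ren A (Suc (n + l + m)) (Suc (n + l + m)) (rot (n + l) m) ?t
      = ren A (Suc (n + m + l)) (Suc (n + l + m))
        (\<lambda>i. rot (n + l) m (if i < n + m + l then swap_blocks n m l i else n + l + m)) t"
    using t rot_less by (intro ren_ren) (auto intro: less_SucI swap_blocks_less)
  also have "\<dots> = ren A (Suc (n + m + l)) (Suc (n + l + m)) (swap_blocks n m (Suc l)) t"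
    by (rule ren_cong) (auto simp: rot_def swap_blocks_def)
  also have "phi A m (Suc (n + l)) (ren A (Suc (n + m + l)) (Suc (n + l + m)) (swap_blocks n m (Suc l)) t)
        (\<lambda>k. ren A (n + l) (Suc (n + l)) (\<lambda>i. i) (?z k))
      = phi A m (Suc (n + l)) (ren A (Suc (n + m + l)) (Suc (n + l + m)) (swap_blocks n m (Suc l)) t)
        (\<lambda>k. ren A n (Suc (n + l)) (\<lambda>i. i) (z k))"
    using z by (intro phi_cong ren_ren) auto
  \<comment> \<open>\<open>y l\<close> has no variables of the \<open>l\<close> block: on it
    \<open>swap_blocks\<close> amounts to weakening \<open>n\<close> to \<open>n + l\<close> beside
    the \<open>m\<close> block, and \<open>ren_phi\<close> takes this weakening out of
    \<open>phi\<close>.\<close>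
  also have "phi A m (n + l) (ren A (n + m + l) (n + l + m) (swap_blocks n m l) ?y) ?z
      = ren A n (n + l) (\<lambda>i. i) (phi A m n (y l) z)"
  proof -
    have "ren A (n + m) (n + l + m) (\<lambda>i. swap_blocks n m l i) (y l)
        = ren A (n + m) (n + l + m) (extend n (n + l) (\<lambda>i. i)) (y l)"
      by (rule ren_cong) (auto simp: swap_blocks_def extend_def)
    then show ?thesis
      unfolding sw_y using yl z by (subst ren_phi) auto
  qed
  finally have *: "phi A m (n + l)
        (ren A (n + m + l) (n + l + m) (swap_blocks n m l) (sub A (n + m + l) t ?y)) ?z
      = sub A (n + l)
      (phi A m (Suc (n + l)) (ren A (Suc (n + m + l)) (Suc (n + l + m)) (swap_blocks n m (Suc l)) t)
        (\<lambda>k. ren A n (Suc (n + l)) (\<lambda>i. i) (z k)))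
      (ren A n (n + l) (\<lambda>i. i) (phi A m n (y l) z))" .
  have "phi A m n (phi A l (n + m) (sub A (n + m + l) t ?y) y) z = phi A l n
      (phi A m (n + l) (ren A (n + m + l) (n + l + m) (swap_blocks n m l) (sub A (n + m + l) t ?y)) ?z)
      (\<lambda>j. phi A m n (y j) z)"
    using Suc.prems t y by (intro Suc.IH sub_in) auto
  then show ?case
    unfolding * by (simp add: phi_Suc)
qed

section \<open>The clone of a substitution algebra\<close>

lemma cset_C_obj [simp]: "cset (C_obj A) = aset A"
  by (simp add: C_obj_def)

lemma iota_C_obj: "i < m \<Longrightarrow> iota (C_obj A) m i = vr m i"
  by (simp add: C_obj_def vr_def ren_def point_def)

lemma mu_C_obj:
  assumes "x \<in> aset A m" and "\<And>i. i < m \<Longrightarrow> u i \<in> aset A n"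
  shows "mu (C_obj A) m n x (\<lambda>i\<in>{..<m}. u i) = phi A m n (ren A m (n + m) (\<lambda>i. n + i) x) u"
proof -
  have "(\<lambda>i\<in>{..<m}. u i) \<in> {..<m} \<rightarrow>\<^sub>E aset A n"
    using assms(2) by auto
  then have "mu (C_obj A) m n x (\<lambda>i\<in>{..<m}. u i)
      = phi A m n (ren A m (n + m) (\<lambda>i. n + i) x) (\<lambda>i\<in>{..<m}. u i)"
    using assms(1) by (simp add: C_obj_def finr_def ren_def)
  also have "\<dots> = phi A m n (ren A m (n + m) (\<lambda>i. n + i) x) u"
    by (rule phi_cong) simp
  finally show ?thesis .
qed

lemma mu_C_obj_PiE:
  assumes "x \<in> aset A m" and "u \<in> {..<m} \<rightarrow>\<^sub>E aset A n"
  shows "mu (C_obj A) m n x u = phi A m n (ren A m (n + m) (\<lambda>i. n + i) x) u"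
  using mu_C_obj[OF assms(1), of u n] assms(2) by (simp add: extensional_restrict PiE_iff)

lemma ren_finr_in: "x \<in> aset A m \<Longrightarrow> ren A m (n + m) (\<lambda>i. n + i) x \<in> aset A (n + m)"
  by (rule ren_in) auto

text \<open>An instance of \<open>phi_phi\<close>. The renamed \<open>x\<close> uses only the
  \<open>l\<close> block, so after the exchange of blocks it is a term weakened past the
  \<open>m\<close> block, and the inner \<open>phi\<close> cancels by
  \<open>phi_weak\<close>.\<close>

lemma phi_assoc:
  assumes x: "x \<in> aset A l" and y: "\<And>j. j < l \<Longrightarrow> y j \<in> aset A m"
    and z: "\<And>k. k < m \<Longrightarrow> z k \<in> aset A n"
  shows "phi A m n (ren A m (n + m) (\<lambda>i. n + i) (phi A l m (ren A l (m + l) (\<lambda>i. m + i) x) y)) z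
    = phi A l n (ren A l (n + l) (\<lambda>i. n + i) x)
        (\<lambda>j. phi A m n (ren A m (n + m) (\<lambda>i. n + i) (y j)) z)"
proof -
  \<comment> \<open>The shift of \<open>m\<close> into \<open>n + m\<close>, extended over the
    \<open>l\<close> block: the form in which \<open>ren_phi\<close> moves it inside the inner
    \<open>phi\<close>.\<close>
  let ?e = "extend m (n + m) (\<lambda>i. n + i)"
  let ?x = "ren A (m + l) (n + m + l) ?e (ren A l (m + l) (\<lambda>i. m + i) x)"
  have e: "?e i < n + m + l" if "i < m + l" for i
    using that by (rule extend_less[rotated]) auto
  have x': "?x \<in> aset A (n + m + l)"
    using e ren_finr_in[OF x] by (rule ren_in)
  have y': "ren A m (n + m) (\<lambda>i. n + i) (y j) \<in> aset A (n + m)" if "j < l" for j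
    using y[OF that] by (rule ren_finr_in)
  have z': "ren A n (n + l) (\<lambda>i. i) (z k) \<in> aset A (n + l)" if "k < m" for k
    using z[OF that] by (auto intro: ren_in)
  \<comment> \<open>Index \<open>i\<close> of \<open>x\<close> goes to \<open>n + m + i\<close> and,
    after the exchange, to \<open>n + i\<close>, which lies below \<open>n + l\<close>.\<close>
  have "?x = ren A l (n + m + l) (\<lambda>i. ?e (m + i)) x"
    using e x by (intro ren_ren) auto
  then have "ren A (n + m + l) (n + l + m) (swap_blocks n m l) ?x
      = ren A l (n + l + m) (\<lambda>i. swap_blocks n m l (?e (m + i))) x"
    using swap_blocks_less e x by (simp add: ren_ren)
  also have "\<dots> = ren A l (n + l + m) (\<lambda>i. n + i) x"
    by (rule ren_cong) (simp add: swap_blocks_def extend_def)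
  also have "\<dots> = ren A (n + l) (n + l + m) (\<lambda>i. i) (ren A l (n + l) (\<lambda>i. n + i) x)"
    using x by (intro ren_ren[symmetric]) auto
  finally have sw: "ren A (n + m + l) (n + l + m) (swap_blocks n m l) ?x
      = ren A (n + l) (n + l + m) (\<lambda>i. i) (ren A l (n + l) (\<lambda>i. n + i) x)" .
  have "phi A m n (ren A m (n + m) (\<lambda>i. n + i) (phi A l m (ren A l (m + l) (\<lambda>i. m + i) x) y)) z
      = phi A m n (phi A l (n + m) ?x (\<lambda>j. ren A m (n + m) (\<lambda>i. n + i) (y j))) z"
    using ren_phi[of m "\<lambda>i. n + i" "n + m", OF _ ren_finr_in[OF x] y] by simp
  also have "\<dots> = phi A l n
      (phi A m (n + l) (ren A (n + m + l) (n + l + m) (swap_blocks n m l) ?x)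
        (\<lambda>k. ren A n (n + l) (\<lambda>i. i) (z k)))
      (\<lambda>j. phi A m n (ren A m (n + m) (\<lambda>i. n + i) (y j)) z)"
    using z x' y' by (rule phi_phi)
  also have "phi A m (n + l) (ren A (n + m + l) (n + l + m) (swap_blocks n m l) ?x)
        (\<lambda>k. ren A n (n + l) (\<lambda>i. i) (z k)) = ren A l (n + l) (\<lambda>i. n + i) x"
    unfolding sw using ren_finr_in[OF x] z' by (rule phi_weak)
  finally show ?thesis .
qed

text \<open>The three laws come from \<open>phi_assoc\<close>, from \<open>phi_vr\<close> on the
  shifted variable, and from \<open>phi_ren\<close> with the identity renaming.\<close>

lemma abstract_clone_C_obj: "abstract_clone (C_obj A)"
proof
  fix m n
  have "phi A m n (act A m (n + m) (finr n m) t) u \<in> aset A n"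
    if "t \<in> aset A m" "u \<in> {..<m} \<rightarrow>\<^sub>E aset A n" for t u
    using phi_in[OF ren_finr_in[OF that(1)] PiE_mem[OF that(2)]] by (simp add: ren_def finr_def)
  then show "mu (C_obj A) m n \<in> cset (C_obj A) m
      \<rightarrow>\<^sub>E ({..<m} \<rightarrow>\<^sub>E cset (C_obj A) n) \<rightarrow>\<^sub>E cset (C_obj A) n"
    by (simp add: C_obj_def)
next
  fix m
  have "restrict (vr m) {..<m} \<in> {..<m} \<rightarrow>\<^sub>E aset A m"
    by (simp add: vr_in)
  moreover have "iota (C_obj A) m = restrict (vr m) {..<m}"
    by (auto simp: C_obj_def vr_def ren_def point_def fun_eq_iff)
  ultimately show "iota (C_obj A) m \<in> {..<m} \<rightarrow>\<^sub>E cset (C_obj A) m"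
    by simp
next
  fix x l y m z n
  assume "x \<in> cset (C_obj A) l" and "y \<in> {..<l} \<rightarrow>\<^sub>E cset (C_obj A) m"
    and "z \<in> {..<m} \<rightarrow>\<^sub>E cset (C_obj A) n"
  then have x: "x \<in> aset A l" and y: "y \<in> {..<l} \<rightarrow>\<^sub>E aset A m" and z: "z \<in> {..<m} \<rightarrow>\<^sub>E aset A n"
    by simp_all
  have yi: "y j \<in> aset A m" if "j < l" for j
    using y that by auto
  have zi: "z k \<in> aset A n" if "k < m" for k
    using z that by auto
  have "mu (C_obj A) m n (mu (C_obj A) l m x y) z
      = phi A m n (ren A m (n + m) (\<lambda>i. n + i) (phi A l m (ren A l (m + l) (\<lambda>i. m + i) x) y)) z"
    using x y z yi by (simp add: mu_C_obj_PiE phi_in ren_finr_in)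
  also have "\<dots> = phi A l n (ren A l (n + l) (\<lambda>i. n + i) x)
      (\<lambda>j. phi A m n (ren A m (n + m) (\<lambda>i. n + i) (y j)) z)"
    using x yi zi by (rule phi_assoc)
  also have "\<dots> = mu (C_obj A) l n x
      (\<lambda>j\<in>{..<l}. phi A m n (ren A m (n + m) (\<lambda>i. n + i) (y j)) z)"
    using x yi zi by (intro mu_C_obj[symmetric] phi_in ren_finr_in)
  also have "(\<lambda>j\<in>{..<l}. phi A m n (ren A m (n + m) (\<lambda>i. n + i) (y j)) z)
      = (\<lambda>j\<in>{..<l}. mu (C_obj A) m n (y j) z)"
    using yi z by (intro restrict_ext) (simp add: mu_C_obj_PiE)
  finally show "mu (C_obj A) m n (mu (C_obj A) l m x y) z
      = mu (C_obj A) l n x (\<lambda>j\<in>{..<l}. mu (C_obj A) m n (y j) z)" .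
next
  fix i m :: nat and y n
  assume i: "i < m" and y: "y \<in> {..<m} \<rightarrow>\<^sub>E cset (C_obj A) n"
  have "ren A m (n + m) (\<lambda>i. n + i) (vr m i) = vr (n + m) (n + i)"
    using i by (intro ren_vr) auto
  moreover have "phi A m n (vr (n + m) (n + i)) y = y i"
    using i y by (intro phi_vr) auto
  ultimately show "mu (C_obj A) m n (iota (C_obj A) m i) y = y i"
    using i y by (simp add: mu_C_obj_PiE iota_C_obj vr_in)
next
  fix x m
  assume "x \<in> cset (C_obj A) m"
  then have x: "x \<in> aset A m" by simp
  have "restrict (iota (C_obj A) m) {..<m} = iota (C_obj A) m"
    by (auto simp: C_obj_def fun_eq_iff)
  then have "mu (C_obj A) m m x (iota (C_obj A) m) = mu (C_obj A) m m x (restrict (vr m) {..<m})"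
    using iota_C_obj by (metis lessThan_iff restrict_ext)
  also have "\<dots> = phi A m m (ren A m (m + m) (\<lambda>i. m + i) x) (\<lambda>i. vr m i)"
    using x vr_in by (rule mu_C_obj)
  \<comment> \<open>Inserting the variables of context \<open>m\<close> folds two copies of
    \<open>m\<close> onto one, which undoes the shift by \<open>m\<close>.\<close>
  also have "\<dots> = ren A (m + m) m (\<lambda>i. if i < m then i else i - m) (ren A m (m + m) (\<lambda>i. m + i) x)"
    using ren_finr_in[OF x, of m] by (intro phi_ren)
  also have "\<dots> = ren A m m (\<lambda>i. if m + i < m then m + i else m + i - m) x"
    using x by (intro ren_ren) auto
  also have "\<dots> = x"
    using x by (intro ren_id) auto
  finally show "mu (C_obj A) m m x (iota (C_obj A) m) = x" .
qed

section \<open>Recovering the substitution algebra from its clone\<close>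

text \<open>Inserting variables is renaming, which returns the action. For \<open>sub\<close>, the
  first of the \<open>m + 1\<close> substitutions inserts \<open>u\<close> and the others insert
  variables, so together they rename; naturality of \<open>sub\<close> then removes the
  shift.\<close>

lemma S_obj_C_obj: "S_obj (C_obj A) = A"
proof (rule subst_alg.equality)
  have vr_mu: "mu (C_obj A) m n t (\<lambda>i\<in>{..<m}. vr n (f i)) = ren A m n f t"
    if f: "\<And>i. i < m \<Longrightarrow> f i < n" and t: "t \<in> aset A m" for m n f t
  proof -
    have "mu (C_obj A) m n t (\<lambda>i\<in>{..<m}. vr n (f i))
        = phi A m n (ren A m (n + m) (\<lambda>i. n + i) t) (\<lambda>i. vr n (f i))"
      using t vr_in[OF f] by (rule mu_C_obj)
    also have "\<dots> = ren A (n + m) n (\<lambda>i. if i < n then i else f (i - n))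
        (ren A m (n + m) (\<lambda>i. n + i) t)"
      using f ren_finr_in[OF t] by (rule phi_ren)
    also have "\<dots> = ren A m n (\<lambda>i. if n + i < n then n + i else f (n + i - n)) t"
      using f t by (intro ren_ren) auto
    finally show ?thesis by simp
  qed
  \<comment> \<open>Equality here is equality of HOL functions; membership in \<open>PiE\<close>
    over \<open>UNIV\<close> expresses extensionality, and \<open>PiE_ext\<close> then compares
    values on the domain.\<close>
  have act_eq: "act (S_obj (C_obj A)) m n = act A m n" for m n
  proof (rule PiE_ext)
    show "act (S_obj (C_obj A)) m n \<in> ({..<m} \<rightarrow>\<^sub>E {..<n}) \<rightarrow>\<^sub>E UNIV"
      by (simp add: S_obj_def)
    show "act A m n \<in> ({..<m} \<rightarrow>\<^sub>E {..<n}) \<rightarrow>\<^sub>E UNIV"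
      using psh.farr_type by (auto simp: PiE_UNIV_iff PiE_iff)
    fix f assume f: "f \<in> {..<m} \<rightarrow>\<^sub>E {..<n}"
    show "act (S_obj (C_obj A)) m n f = act A m n f"
    proof (rule PiE_ext)
      show "act (S_obj (C_obj A)) m n f \<in> aset A m \<rightarrow>\<^sub>E UNIV"
        using f by (simp add: S_obj_def)
      show "act A m n f \<in> aset A m \<rightarrow>\<^sub>E UNIV"
        using act_type[OF f] by (auto simp: PiE_iff)
      fix t assume t: "t \<in> aset A m"
      have f': "f i < n" if "i < m" for i
        using f that by auto
      have "(\<lambda>i\<in>{..<m}. iota (C_obj A) n (f i)) = (\<lambda>i\<in>{..<m}. vr n (f i))"
        using f' by (intro restrict_ext) (simp add: iota_C_obj)
      then show "act (S_obj (C_obj A)) m n f t = act A m n f t"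
        using f f' t by (simp add: S_obj_def vr_mu act_eq_ren)
    qed
  qed
  show "psh (S_obj (C_obj A)) = psh A"
  proof (rule func.equality)
    show "fobj (psh (S_obj (C_obj A))) = fobj (psh A)"
      by (simp add: S_obj_def)
    show "farr (psh (S_obj (C_obj A))) = farr (psh A)"
      by (intro ext[of "farr _"] ext) (simp add: act_eq)
  qed simp
  show "sub (S_obj (C_obj A)) = sub A"
  proof
    fix m
    show "sub (S_obj (C_obj A)) m = sub A m"
    proof (rule PiE_ext)
      show "sub (S_obj (C_obj A)) m \<in> aset A (m + 1) \<rightarrow>\<^sub>E UNIV"
        by (simp add: S_obj_def)
      show "sub A m \<in> aset A (m + 1) \<rightarrow>\<^sub>E UNIV"
        using sub_type by (auto simp: PiE_iff)
      fix t assume t: "t \<in> aset A (m + 1)"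
      show "sub (S_obj (C_obj A)) m t = sub A m t"
      proof (rule PiE_ext)
        show "sub (S_obj (C_obj A)) m t \<in> aset A m \<rightarrow>\<^sub>E UNIV"
          using t by (simp add: S_obj_def)
        show "sub A m t \<in> aset A m \<rightarrow>\<^sub>E UNIV"
          using PiE_mem[OF sub_type t] by (auto simp: PiE_iff)
        fix u assume u: "u \<in> aset A m"
        let ?u = "\<lambda>i. if i < m then vr m i else u"
        \<comment> \<open>The codiagonal from \<open>m + m\<close> to \<open>m\<close>. It undoes
          the inclusion in \<open>?z\<close>, and \<open>?g + id\<close> undoes the shift in
          \<open>?k\<close>.\<close>
        let ?g = "\<lambda>i. if i < m then i else i - m"
        let ?k = "ren A (Suc m) (Suc (m + m)) (\<lambda>i. m + i) t"
        let ?z = "ren A m (m + m) (\<lambda>i. i) u"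
        have t': "t \<in> aset A (Suc m)"
          using t by simp
        have k: "?k \<in> aset A (Suc (m + m))"
          using ren_finr_in[OF t', of m] by simp
        have z: "?z \<in> aset A (m + m)"
          using u by (auto intro: ren_in)
        have "(\<lambda>i\<in>{..<m + 1}. if i < m then iota (C_obj A) m i else u) = (\<lambda>i\<in>{..<Suc m}. ?u i)"
          by (auto simp: iota_C_obj fun_eq_iff)
        then have "sub (S_obj (C_obj A)) m t u = mu (C_obj A) (Suc m) m t (\<lambda>i\<in>{..<Suc m}. ?u i)"
          using t u by (simp add: S_obj_def)
        also have "\<dots> = phi A (Suc m) m ?k ?u"
          using mu_C_obj[OF t', of ?u m] u by (simp add: vr_in)
        also have "\<dots> = phi A m m (sub A (m + m) ?k ?z) (\<lambda>i. vr m i)"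
          by (simp add: phi_Suc) (rule phi_cong, simp)
        also have "\<dots> = ren A (m + m) m ?g (sub A (m + m) ?k ?z)"
          using sub_in[OF k z] by (intro phi_ren)
        also have "\<dots> = sub A m
            (ren A (Suc (m + m)) (Suc m) (\<lambda>i. if i < m + m then ?g i else m) ?k)
            (ren A (m + m) m ?g ?z)"
          using k z by (intro ren_sub) auto
        also have "ren A (Suc (m + m)) (Suc m) (\<lambda>i. if i < m + m then ?g i else m) ?k
            = ren A (Suc m) (Suc m) (\<lambda>i. if m + i < m + m then ?g (m + i) else m) t"
          using t' by (intro ren_ren) auto
        also have "\<dots> = t"
          using t' by (intro ren_id) auto
        also have "ren A (m + m) m ?g ?z = ren A m m (\<lambda>i. ?g i) u"
          using u by (intro ren_ren) auto
        also have "\<dots> = u"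
          using u by (intro ren_id) auto
        finally show "sub (S_obj (C_obj A)) m t u = sub A m t u" .
      qed
    qed
  qed
  show "var (S_obj (C_obj A)) = var A"
    by (simp add: S_obj_def iota_C_obj vr_last fun_eq_iff)
qed simp

end

section \<open>Algebra homomorphisms as clone homomorphisms\<close>

text \<open>\<open>mu\<close> and \<open>iota\<close> are composed of \<open>act\<close>,
  \<open>sub\<close> and \<open>var\<close>, which \<open>h\<close> respects; for \<open>phi\<close>
  this is an induction on the number of substitutions.\<close>

lemma clone_hom_C_obj:
  assumes A: "substitution_algebra A" and A': "substitution_algebra A'"
    and h: "subst_alg_hom A A' h"
  shows "clone_hom (C_obj A) (C_obj A') h"
proof -
  interpret A: substitution_algebra A by fact
  interpret A': substitution_algebra A' by fact
  have h_in: "x \<in> aset A m \<Longrightarrow> h m x \<in> aset A' m" for m x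
    by (rule subst_alg_homD(2)[OF h])
  have h_ren: "h n (ren A m n f x) = ren A' m n f (h m x)"
    if "\<And>i. i < m \<Longrightarrow> f i < n" and "x \<in> aset A m" for m n f x
    unfolding ren_def using that by (intro subst_alg_homD(3)[OF h]) auto
  have h_var: "h (Suc m) (var A m) = var A' m" for m
    using subst_alg_homD(4)[OF h, of m] by simp
  have h_vr: "h m (A.vr m i) = A'.vr m i" if "i < m" for m i
    using that A.var_in[of 0] h_var[of 0]
    by (simp add: A.vr_def A'.vr_def h_ren)
  have h_phi: "t \<in> aset A (n + m) \<Longrightarrow> (\<And>i. i < m \<Longrightarrow> u i \<in> aset A n) \<Longrightarrow>
      h n (phi A m n t u) = phi A' m n (h (n + m) t) (\<lambda>i. h n (u i))" for m n t u
  proof (induction m arbitrary: t)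
    case (Suc m)
    have um: "ren A n (n + m) (\<lambda>i. i) (u m) \<in> aset A (n + m)"
      using Suc.prems by (auto intro: A.ren_in)
    have t: "t \<in> aset A (Suc (n + m))"
      using Suc.prems by simp
    have "h (n + m) (sub A (n + m) t (ren A n (n + m) (\<lambda>i. i) (u m)))
        = sub A' (n + m) (h (Suc (n + m)) t) (ren A' n (n + m) (\<lambda>i. i) (h n (u m)))"
      using subst_alg_homD(5)[OF h, of t "n + m"] t um Suc.prems(2) by (simp add: h_ren)
    then show ?case
      using Suc t um by (simp add: A.phi_Suc A'.phi_Suc A.sub_in)
  qed simp
  show ?thesis
  proof (rule clone_homI)
    show "h m \<in> cset (C_obj A) m \<rightarrow>\<^sub>E cset (C_obj A') m" for m
      using subst_alg_homD(1)[OF h] by simp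
    show "h m (iota (C_obj A) m i) = iota (C_obj A') m i" if "i < m" for m i
      using that by (simp add: A.iota_C_obj A'.iota_C_obj h_vr)
    fix m n x y
    assume "x \<in> cset (C_obj A) m" and "y \<in> {..<m} \<rightarrow>\<^sub>E cset (C_obj A) n"
    then have x: "x \<in> aset A m" and y: "y \<in> {..<m} \<rightarrow>\<^sub>E aset A n"
      by simp_all
    have yi: "y i \<in> aset A n" if "i < m" for i
      using y that by auto
    have "h n (mu (C_obj A) m n x y)
        = phi A' m n (h (n + m) (ren A m (n + m) (\<lambda>i. n + i) x)) (\<lambda>i. h n (y i))"
      using x y yi by (simp add: A.mu_C_obj_PiE h_phi A.ren_finr_in)
    also have "h (n + m) (ren A m (n + m) (\<lambda>i. n + i) x) = ren A' m (n + m) (\<lambda>i. n + i) (h m x)"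
      using x by (intro h_ren) auto
    also have "phi A' m n (ren A' m (n + m) (\<lambda>i. n + i) (h m x)) (\<lambda>i. h n (y i))
        = mu (C_obj A') m n (h m x) (\<lambda>i\<in>{..<m}. h n (y i))"
      using x yi by (intro A'.mu_C_obj[symmetric] h_in)
    finally show "h n (mu (C_obj A) m n x y)
        = mu (C_obj A') m n (h m x) (\<lambda>i\<in>{..<m}. h n (y i))" .
  qed
qed

section \<open>From abstract clones to substitution algebras\<close>

context abstract_clone
begin

text \<open>The counterpart of \<open>ren\<close> for tuples: the truncation is built in, so tuples
  given by case distinctions can be compared index by index.\<close>

definition msub :: "nat \<Rightarrow> nat \<Rightarrow> 'a \<Rightarrow> (nat \<Rightarrow> 'a) \<Rightarrow> 'a" where
  "msub m n x y = mu C m n x (restrict y {..<m})"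

lemma mu_eq_msub: "y \<in> {..<m} \<rightarrow>\<^sub>E X \<Longrightarrow> mu C m n x y = msub m n x y"
  by (simp add: msub_def PiE_restrict)

lemma msub_in: "x \<in> cset C m \<Longrightarrow> (\<And>i. i < m \<Longrightarrow> y i \<in> cset C n) \<Longrightarrow> msub m n x y \<in> cset C n"
  unfolding msub_def by (rule mu_in) auto

lemma msub_cong: "(\<And>i. i < m \<Longrightarrow> y i = y' i) \<Longrightarrow> msub m n x y = msub m n x y'"
  unfolding msub_def by (metis lessThan_iff restrict_ext)

lemma msub_msub:
  assumes "x \<in> cset C l" and "\<And>i. i < l \<Longrightarrow> y i \<in> cset C m" and "\<And>i. i < m \<Longrightarrow> z i \<in> cset C n"
  shows "msub m n (msub l m x y) z = msub l n x (\<lambda>j. msub m n (y j) z)"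
proof -
  have "restrict y {..<l} \<in> {..<l} \<rightarrow>\<^sub>E cset C m" "restrict z {..<m} \<in> {..<m} \<rightarrow>\<^sub>E cset C n"
    using assms by auto
  then have "msub m n (msub l m x y) z
      = mu C l n x (\<lambda>j\<in>{..<l}. mu C m n (restrict y {..<l} j) (restrict z {..<m}))"
    unfolding msub_def using assms(1) by (rule mu_assoc[rotated])
  also have "\<dots> = msub l n x (\<lambda>j. msub m n (y j) z)"
    unfolding msub_def by (rule arg_cong[where f = "mu C l n x"]) (auto simp: fun_eq_iff)
  finally show ?thesis .
qed

lemma msub_iota:
  assumes "i < m" and "\<And>i. i < m \<Longrightarrow> y i \<in> cset C n"
  shows "msub m n (iota C m i) y = y i"
  using mu_iota_left[of i m "restrict y {..<m}" n] assms by (simp add: msub_def PiE_iff)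

lemma msub_id:
  assumes "x \<in> cset C m" and "\<And>i. i < m \<Longrightarrow> y i = iota C m i"
  shows "msub m m x y = x"
proof -
  have "msub m m x y = msub m m x (iota C m)"
    using assms(2) by (rule msub_cong)
  then show ?thesis
    using mu_iota_right[OF assms(1)] iota_type[of m] by (simp add: msub_def PiE_restrict)
qed

section \<open>The substitution algebra of a clone\<close>

lemma aset_S_obj [simp]: "aset (S_obj C) = cset C"
  by (simp add: S_obj_def)

lemma act_S_obj:
  "f \<in> {..<m} \<rightarrow>\<^sub>E {..<n} \<Longrightarrow> x \<in> cset C m \<Longrightarrow>
    act (S_obj C) m n f x = msub m n x (\<lambda>i. iota C n (f i))"
  by (simp add: S_obj_def msub_def)

lemma sub_S_obj:
  "x \<in> cset C (Suc m) \<Longrightarrow> y \<in> cset C m \<Longrightarrow>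
    sub (S_obj C) m x y = msub (Suc m) m x (\<lambda>i. if i < m then iota C m i else y)"
  by (simp add: S_obj_def msub_def)

lemma var_S_obj: "var (S_obj C) m = iota C (Suc m) m"
  by (simp add: S_obj_def)

text \<open>The identity law is the right unit law of the clone; the composition law is
  associativity followed by the left unit law on each variable.\<close>

lemma functor_psh_S_obj: "cat_functor FF SET (psh (S_obj C))"
proof (intro cat_functor.intro category_FF category_SET cat_functor_axioms.intro)
  show "fobj (psh (S_obj C)) \<in> obj FF \<rightarrow>\<^sub>E obj SET"
    by simp
  have "act (S_obj C) m n \<in> ({..<m} \<rightarrow>\<^sub>E {..<n}) \<rightarrow>\<^sub>E cset C m \<rightarrow>\<^sub>E cset C n" for m n
  proof -
    have "mu C m n t (\<lambda>i\<in>{..<m}. iota C n (f i)) \<in> cset C n"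
      if "t \<in> cset C m" "f \<in> {..<m} \<rightarrow>\<^sub>E {..<n}" for t f
      using that by (intro mu_in) (auto intro!: iota_in)
    then show ?thesis
      by (simp add: S_obj_def)
  qed
  then show "act (S_obj C) \<in> (\<Pi>\<^sub>E m\<in>obj FF. \<Pi>\<^sub>E n\<in>obj FF.
      hom FF m n \<rightarrow>\<^sub>E hom SET (aset (S_obj C) m) (aset (S_obj C) n))"
    by (simp add: PiE_UNIV_iff)
  show "act (S_obj C) m m (idn FF m) = idn SET (aset (S_obj C) m)" for m
  proof -
    have "msub m m t (\<lambda>i. iota C m (if i \<in> {..<m} then i else undefined)) = t" if "t \<in> cset C m" for t
      using that by (rule msub_id) simp
    then show ?thesis
      by (auto simp: S_obj_def msub_def restrict_def fun_eq_iff)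
  qed
  fix l m n f g
  assume "f \<in> hom FF l m" and "g \<in> hom FF m n"
  then have f: "f \<in> {..<l} \<rightarrow>\<^sub>E {..<m}" and g: "g \<in> {..<m} \<rightarrow>\<^sub>E {..<n}"
    by simp_all
  have fi: "f i < m" if "i < l" for i
    using f that by auto
  have gi: "g i < n" if "i < m" for i
    using g that by auto
  have gf: "compose {..<l} g f \<in> {..<l} \<rightarrow>\<^sub>E {..<n}"
    using f g by (rule compose_PiE)
  have "act (S_obj C) l n (compose {..<l} g f) t = act (S_obj C) m n g (act (S_obj C) l m f t)"
    if t: "t \<in> cset C l" for t
  proof -
    have "act (S_obj C) m n g (act (S_obj C) l m f t)
        = msub m n (msub l m t (\<lambda>i. iota C m (f i))) (\<lambda>i. iota C n (g i))"
      using f g t fi by (simp add: act_S_obj msub_in iota_in)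
    also have "\<dots> = msub l n t (\<lambda>j. msub m n (iota C m (f j)) (\<lambda>i. iota C n (g i)))"
      using t fi gi by (intro msub_msub iota_in)
    also have "\<dots> = msub l n t (\<lambda>i. iota C n (compose {..<l} g f i))"
      using fi gi by (intro msub_cong) (simp add: msub_iota iota_in compose_def)
    finally show ?thesis
      using t gf by (simp add: act_S_obj)
  qed
  then have "compose (cset C l) (act (S_obj C) m n g) (act (S_obj C) l m f)
      = restrict (act (S_obj C) l n (compose {..<l} g f)) (cset C l)"
    by (auto simp: compose_def)
  also have "\<dots> = act (S_obj C) l n (compose {..<l} g f)"
    using gf by (simp add: S_obj_def)
  finally show "act (S_obj C) l n (cmp FF l m n g f) = cmp SET (aset (S_obj C) l)
      (aset (S_obj C) m) (aset (S_obj C) n) (act (S_obj C) m n g) (act (S_obj C) l m f)"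
    by simp
qed

text \<open>In the axioms with nested substitutions, \<open>msub_msub\<close> merges them into one
  simultaneous substitution into \<open>x\<close>; the tuples are then compared entry by
  entry.\<close>

lemma substitution_algebra_S_obj: "substitution_algebra (S_obj C)"
proof (rule substitution_algebra.intro)
  fix m
  show "sub (S_obj C) m \<in> aset (S_obj C) (m + 1) \<rightarrow>\<^sub>E aset (S_obj C) m \<rightarrow>\<^sub>E aset (S_obj C) m"
  proof -
    have "mu C (Suc m) m t (\<lambda>i\<in>{..<Suc m}. if i < m then iota C m i else u) \<in> cset C m"
      if "t \<in> cset C (Suc m)" "u \<in> cset C m" for t u
      using that by (intro mu_in) (auto intro!: iota_in)
    then show ?thesis
      by (simp add: S_obj_def)
  qed
  show "var (S_obj C) m \<in> aset (S_obj C) (m + 1)"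
    by (simp add: var_S_obj iota_in)
next
  fix f m n x y
  assume "f \<in> hom FF m n" and "x \<in> aset (S_obj C) (m + 1)" and "y \<in> aset (S_obj C) m"
  then have f: "f \<in> {..<m} \<rightarrow>\<^sub>E {..<n}" and x: "x \<in> cset C (Suc m)" and y: "y \<in> cset C m"
    by simp_all
  let ?f = "fplus m 1 n f (idn FF 1)"
  let ?y = "msub m n y (\<lambda>i. iota C n (f i))"
  have fi: "f i < n" if "i < m" for i
    using f that by auto
  have f': "?f \<in> {..<Suc m} \<rightarrow>\<^sub>E {..<Suc n}"
    using fi by (auto simp: fplus_def less_SucI)
  have f'i: "?f i < Suc n" if "i < Suc m" for i
    using f' that by auto
  have y': "?y \<in> cset C n"
    using y fi by (intro msub_in iota_in)
  have "act (S_obj C) m n f (sub (S_obj C) m x y)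
      = msub m n (msub (Suc m) m x (\<lambda>i. if i < m then iota C m i else y)) (\<lambda>i. iota C n (f i))"
    using f x y by (simp add: sub_S_obj act_S_obj msub_in iota_in)
  also have "\<dots> = msub (Suc m) n x
      (\<lambda>j. msub m n (if j < m then iota C m j else y) (\<lambda>i. iota C n (f i)))"
    using x y fi by (intro msub_msub) (auto intro: iota_in)
  \<comment> \<open>Below \<open>m\<close> both entries are the variable \<open>f j\<close>; at
    \<open>j = m\<close> the map \<open>?f\<close> yields \<open>n\<close>, where the tuple holds
    \<open>?y\<close>.\<close>
  also have "\<dots> = msub (Suc m) n x
      (\<lambda>j. msub (Suc n) n (iota C (Suc n) (?f j)) (\<lambda>i. if i < n then iota C n i else ?y))"
    using fi f'i y' by (intro msub_cong) (auto simp: msub_iota iota_in fplus_def)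
  also have "\<dots> = msub (Suc n) n (msub (Suc m) (Suc n) x (\<lambda>i. iota C (Suc n) (?f i)))
      (\<lambda>i. if i < n then iota C n i else ?y)"
    using x y' f'i by (intro msub_msub[symmetric]) (auto intro: iota_in)
  also have "\<dots> = sub (S_obj C) n (act (S_obj C) (m + 1) (n + 1) ?f x) (act (S_obj C) m n f y)"
    using x y y' f f' f'i by (simp add: sub_S_obj act_S_obj msub_in iota_in del: FF_simps)
  finally show "act (S_obj C) m n f (sub (S_obj C) m x y)
      = sub (S_obj C) n (act (S_obj C) (m + 1) (n + 1) ?f x) (act (S_obj C) m n f y)" .
next
  fix f m n
  assume "f \<in> hom FF m n"
  then have "\<And>i. i < m \<Longrightarrow> f i < n"
    by auto
  then have "fplus m 1 n f (idn FF 1) \<in> {..<Suc m} \<rightarrow>\<^sub>E {..<Suc n}"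
    by (auto simp: fplus_def less_SucI)
  moreover from this have "fplus m 1 n f (idn FF 1) i < Suc n" if "i < Suc m" for i
    using that by auto
  moreover have "fplus m 1 n f (idn FF 1) m = n"
    by (simp add: fplus_def)
  ultimately show "act (S_obj C) (m + 1) (n + 1) (fplus m 1 n f (idn FF 1)) (var (S_obj C) m)
      = var (S_obj C) n"
    by (simp add: var_S_obj act_S_obj iota_in msub_iota del: FF_simps)
next
  fix m x
  assume "x \<in> aset (S_obj C) m"
  then show "sub (S_obj C) m (var (S_obj C) m) x = x"
    by (simp add: var_S_obj sub_S_obj iota_in msub_iota)
next
  fix m x
  let ?c = "fplus m 2 m (idn FF m) contr"
  assume "x \<in> aset (S_obj C) (m + 2)"
  then have x: "x \<in> cset C (Suc (Suc m))"
    by simp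
  have c: "?c \<in> {..<Suc (Suc m)} \<rightarrow>\<^sub>E {..<Suc m}"
    by (auto simp: fplus_def contr_def)
  have "msub (Suc (Suc m)) (Suc m) x (\<lambda>i. if i < Suc m then iota C (Suc m) i else iota C (Suc m) m)
      = msub (Suc (Suc m)) (Suc m) x (\<lambda>i. iota C (Suc m) (?c i))"
    by (rule msub_cong) (auto simp: fplus_def contr_def less_Suc_eq)
  then show "sub (S_obj C) (m + 1) x (var (S_obj C) m) = act (S_obj C) (m + 2) (m + 1) ?c x"
    using x c by (simp add: var_S_obj sub_S_obj act_S_obj iota_in)
next
  fix m x y
  assume "x \<in> aset (S_obj C) m" and "y \<in> aset (S_obj C) m"
  then have x: "x \<in> cset C m" and y: "y \<in> cset C m"
    by simp_all
  have w: "fplus m 0 m (idn FF m) weak = (\<lambda>i\<in>{..<m}. i)"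
    by (auto simp: fplus_def fun_eq_iff)
  have "msub (Suc m) m (msub m (Suc m) x (\<lambda>i. iota C (Suc m) ((\<lambda>i\<in>{..<m}. i) i)))
        (\<lambda>i. if i < m then iota C m i else y)
      = msub m m x (\<lambda>j. msub (Suc m) m (iota C (Suc m) ((\<lambda>i\<in>{..<m}. i) j))
        (\<lambda>i. if i < m then iota C m i else y))"
    using x y by (intro msub_msub) (auto intro: iota_in)
  also have "\<dots> = x"
    using x y by (intro msub_id) (auto simp: msub_iota iota_in)
  finally show "sub (S_obj C) m (act (S_obj C) m (m + 1) (fplus m 0 m (idn FF m) weak) x) y = x"
    unfolding w using x y by (simp add: sub_S_obj act_S_obj msub_in iota_in PiE_iff)
next
  fix m x y z
  assume "x \<in> aset (S_obj C) (m + 2)" and "y \<in> aset (S_obj C) (m + 1)" and "z \<in> aset (S_obj C) m"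
  then have x: "x \<in> cset C (Suc (Suc m))" and y: "y \<in> cset C (Suc m)" and z: "z \<in> cset C m"
    by simp_all
  let ?w = "\<lambda>i\<in>{..<m}. i"
  have w: "fplus m 0 m (idn FF m) weak = ?w"
    by (auto simp: fplus_def fun_eq_iff)
  have w_in: "?w \<in> {..<m} \<rightarrow>\<^sub>E {..<Suc m}"
    by auto
  let ?s = "fplus m 2 m (idn FF m) swap2"
  let ?z = "\<lambda>i. if i < m then iota C m i else z"
  define wz where "wz = msub m (Suc m) z (\<lambda>i. iota C (Suc m) (?w i))"
  let ?yz = "msub (Suc m) m y ?z"
  \<comment> \<open>The common normal form: \<open>z\<close> at index \<open>m\<close>, and at
    \<open>m + 1\<close> the term \<open>y\<close> with \<open>z\<close> already inserted.\<close>
  let ?xyz = "\<lambda>i. if i < m then iota C m i else if i = m then z else ?yz"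
  have s: "?s \<in> {..<Suc (Suc m)} \<rightarrow>\<^sub>E {..<Suc (Suc m)}"
    by (auto simp: fplus_def swap2_def)
  have si: "?s i < Suc (Suc m)" if "i < Suc (Suc m)" for i
    using s that by auto
  have wz: "wz \<in> cset C (Suc m)"
    unfolding wz_def using z by (intro msub_in iota_in) auto
  have w_act: "act (S_obj C) m (Suc m) ?w z = wz"
    using act_S_obj[OF w_in z] unfolding wz_def .
  have yz: "?yz \<in> cset C m"
    using y z by (intro msub_in) (auto intro: iota_in)
  \<comment> \<open>For index \<open>m\<close>, which \<open>?s\<close> sends to
    \<open>m + 1\<close>, where \<open>wz\<close> is inserted: substituting into the weakened
    \<open>z\<close> returns \<open>z\<close>.\<close>
  have wz_sub: "msub (Suc m) m wz (\<lambda>i. if i < m then iota C m i else ?yz) = z"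
  proof -
    have "msub (Suc m) m wz (\<lambda>i. if i < m then iota C m i else ?yz)
        = msub m m z (\<lambda>j. msub (Suc m) m (iota C (Suc m) (?w j))
            (\<lambda>i. if i < m then iota C m i else ?yz))"
      unfolding wz_def using z yz by (intro msub_msub) (auto intro: iota_in)
    also have "\<dots> = z"
      using z yz by (intro msub_id) (auto simp: msub_iota iota_in)
    finally show ?thesis .
  qed
  have "sub (S_obj C) m (sub (S_obj C) (m + 1) x y) z
      = msub (Suc m) m (msub (Suc (Suc m)) (Suc m) x
          (\<lambda>i. if i < Suc m then iota C (Suc m) i else y)) ?z"
    using x y z by (simp add: sub_S_obj msub_in iota_in)
  also have "\<dots> = msub (Suc (Suc m)) m x
      (\<lambda>j. msub (Suc m) m (if j < Suc m then iota C (Suc m) j else y) ?z)"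
    using x y z by (intro msub_msub) (auto intro: iota_in)
  also have "\<dots> = msub (Suc (Suc m)) m x ?xyz"
    using z by (intro msub_cong) (auto simp: msub_iota iota_in)
  also have "\<dots> = msub (Suc (Suc m)) m x (\<lambda>j. msub (Suc m) m
      (if ?s j < Suc m then iota C (Suc m) (?s j) else wz)
      (\<lambda>i. if i < m then iota C m i else ?yz))"
    using yz wz_sub by (intro msub_cong) (auto simp: msub_iota iota_in fplus_def swap2_def)
  also have "\<dots> = msub (Suc m) m (msub (Suc (Suc m)) (Suc m) x
        (\<lambda>j. if ?s j < Suc m then iota C (Suc m) (?s j) else wz))
      (\<lambda>i. if i < m then iota C m i else ?yz)"
    using x wz yz by (intro msub_msub[symmetric]) (auto intro: iota_in)
  \<comment> \<open>Each entry becomes a substitution instance of a variable, so that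
    \<open>msub_msub\<close> read backwards splits off the renaming by \<open>?s\<close>.\<close>
  also have "msub (Suc (Suc m)) (Suc m) x (\<lambda>j. if ?s j < Suc m then iota C (Suc m) (?s j) else wz)
      = msub (Suc (Suc m)) (Suc m) x (\<lambda>j. msub (Suc (Suc m)) (Suc m) (iota C (Suc (Suc m)) (?s j))
          (\<lambda>i. if i < Suc m then iota C (Suc m) i else wz))"
    using si wz by (intro msub_cong) (simp add: msub_iota iota_in)
  also have "\<dots> = msub (Suc (Suc m)) (Suc m)
      (msub (Suc (Suc m)) (Suc (Suc m)) x (\<lambda>j. iota C (Suc (Suc m)) (?s j)))
      (\<lambda>i. if i < Suc m then iota C (Suc m) i else wz)"
    using x si wz by (intro msub_msub[symmetric]) (auto intro: iota_in)
  also have "msub (Suc m) m \<dots> (\<lambda>i. if i < m then iota C m i else ?yz)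
      = sub (S_obj C) m
          (sub (S_obj C) (m + 1) (act (S_obj C) (m + 2) (m + 2) ?s x)
            (act (S_obj C) m (m + 1) ?w z))
          (sub (S_obj C) m y z)"
    using x y z wz yz si
    by (simp add: sub_S_obj act_S_obj[OF s] w_act msub_in iota_in del: FF_simps)
  finally show "sub (S_obj C) m (sub (S_obj C) (m + 1) x y) z
      = sub (S_obj C) m
          (sub (S_obj C) (m + 1) (act (S_obj C) (m + 2) (m + 2) ?s x)
            (act (S_obj C) m (m + 1) (fplus m 0 m (idn FF m) weak) z))
          (sub (S_obj C) m y z)"
    unfolding w .
qed (rule functor_psh_S_obj)

section \<open>Recovering the clone from its substitution algebra\<close>

text \<open>Eliminating the top variable inserts the weakened \<open>u m\<close>; the simultaneous
  substitution that follows fixes the first \<open>n\<close> variables and so returns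
  \<open>u m\<close>. Associativity merges the two.\<close>

lemma phi_S_obj:
  "t \<in> cset C (n + m) \<Longrightarrow> (\<And>i. i < m \<Longrightarrow> u i \<in> cset C n) \<Longrightarrow>
    phi (S_obj C) m n t u = msub (n + m) n t (\<lambda>i. if i < n then iota C n i else u (i - n))"
proof (induction m arbitrary: t)
  case 0
  then show ?case by (simp add: msub_id)
next
  case (Suc m)
  let ?u = "\<lambda>i. if i < n then iota C n i else u (i - n)"
  let ?z = "msub n (n + m) (u m) (\<lambda>i. iota C (n + m) i)"
  have t: "t \<in> cset C (Suc (n + m))" and um: "u m \<in> cset C n"
    using Suc.prems by auto
  have u: "?u i \<in> cset C n" if "i < n + m" for i
    using Suc.prems(2)[of "i - n"] that by (auto intro: iota_in)
  have j: "finl n \<in> {..<n} \<rightarrow>\<^sub>E {..<n + m}"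
    by (auto simp: finl_def)
  have z: "?z \<in> cset C (n + m)"
    using um by (intro msub_in iota_in) auto
  have act: "act (S_obj C) n (n + m) (finl n) (u m) = ?z"
    unfolding act_S_obj[OF j um] by (rule msub_cong) (simp add: finl_def)
  have sub: "sub (S_obj C) (n + m) t ?z
      = msub (Suc (n + m)) (n + m) t (\<lambda>i. if i < n + m then iota C (n + m) i else ?z)"
    using t z by (rule sub_S_obj)
  have "msub (n + m) n ?z ?u = msub n n (u m) (\<lambda>j. msub (n + m) n (iota C (n + m) j) ?u)"
    using um u by (intro msub_msub iota_in) auto
  also have "\<dots> = u m"
    using um u by (intro msub_id) (auto simp: msub_iota)
  finally have z_u: "msub (n + m) n ?z ?u = u m" .
  have "phi (S_obj C) (Suc m) n t u = msub (n + m) n (sub (S_obj C) (n + m) t ?z) ?u"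
    unfolding phi.simps act
  proof (rule Suc.IH)
    show "sub (S_obj C) (n + m) t ?z \<in> cset C (n + m)"
      unfolding sub using t z by (auto intro!: msub_in iota_in)
  qed (use Suc.prems(2) in simp)
  also have "\<dots> = msub (Suc (n + m)) n t
      (\<lambda>j. msub (n + m) n (if j < n + m then iota C (n + m) j else ?z) ?u)"
    unfolding sub using t z u by (intro msub_msub) (auto intro: iota_in)
  also have "\<dots> = msub (Suc (n + m)) n t ?u"
    using u z_u by (intro msub_cong) (auto simp: msub_iota less_Suc_eq)
  finally show ?case by simp
qed

text \<open>For \<open>mu\<close>, the shift by \<open>n\<close> sends the variables of
  \<open>x\<close> into the upper block, so in the substitution given by \<open>phi_S_obj\<close>
  they meet the entries of \<open>y\<close>. For \<open>iota\<close>, renaming the variable of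
  context \<open>1\<close> is the left unit law.\<close>

lemma C_obj_S_obj: "C_obj (S_obj C) = C"
proof (rule clone.equality)
  show "cset (C_obj (S_obj C)) = cset C"
    by (simp add: C_obj_def)
  show "mu (C_obj (S_obj C)) = mu C"
  proof (intro ext[of "mu _"] ext[of "mu _ _"])
    fix m n
    show "mu (C_obj (S_obj C)) m n = mu C m n"
    proof (rule PiE_ext)
      show "mu (C_obj (S_obj C)) m n \<in> cset C m \<rightarrow>\<^sub>E UNIV"
        by (simp add: C_obj_def)
      show "mu C m n \<in> cset C m \<rightarrow>\<^sub>E UNIV"
        using mu_type by (auto simp: PiE_iff)
      fix x assume x: "x \<in> cset C m"
      show "mu (C_obj (S_obj C)) m n x = mu C m n x"
      proof (rule PiE_ext)
        show "mu (C_obj (S_obj C)) m n x \<in> ({..<m} \<rightarrow>\<^sub>E cset C n) \<rightarrow>\<^sub>E UNIV"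
          using x by (simp add: C_obj_def)
        show "mu C m n x \<in> ({..<m} \<rightarrow>\<^sub>E cset C n) \<rightarrow>\<^sub>E UNIV"
          using PiE_mem[OF mu_type x] by (auto simp: PiE_iff)
        fix y assume y: "y \<in> {..<m} \<rightarrow>\<^sub>E cset C n"
        let ?y = "\<lambda>i. if i < n then iota C n i else y (i - n)"
        let ?x = "msub m (n + m) x (\<lambda>i. iota C (n + m) (n + i))"
        have yi: "y i \<in> cset C n" if "i < m" for i
          using y that by auto
        have y': "?y i \<in> cset C n" if "i < n + m" for i
          using yi[of "i - n"] that by (auto intro: iota_in)
        have x': "?x \<in> cset C (n + m)"
          using x by (intro msub_in iota_in) auto
        have k: "finr n m \<in> {..<m} \<rightarrow>\<^sub>E {..<n + m}"
          by (auto simp: finr_def)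
        have "act (S_obj C) m (n + m) (finr n m) x = ?x"
          unfolding act_S_obj[OF k x] by (rule msub_cong) (simp add: finr_def)
        then have "mu (C_obj (S_obj C)) m n x y = phi (S_obj C) m n ?x y"
          using x y by (simp add: C_obj_def)
        also have "\<dots> = msub (n + m) n ?x ?y"
          using x' yi by (rule phi_S_obj)
        also have "\<dots> = msub m n x (\<lambda>j. msub (n + m) n (iota C (n + m) (n + j)) ?y)"
          using x y' by (intro msub_msub iota_in) auto
        also have "\<dots> = msub m n x y"
          using y' by (intro msub_cong) (simp add: msub_iota)
        also have "\<dots> = mu C m n x y"
          using y by (simp add: mu_eq_msub)
        finally show "mu (C_obj (S_obj C)) m n x y = mu C m n x y" .
      qed
    qed
  qed
  show "iota (C_obj (S_obj C)) = iota C"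
  proof
    fix m
    show "iota (C_obj (S_obj C)) m = iota C m"
    proof (rule PiE_ext)
      show "iota (C_obj (S_obj C)) m \<in> {..<m} \<rightarrow>\<^sub>E UNIV"
        by (simp add: C_obj_def)
      show "iota C m \<in> {..<m} \<rightarrow>\<^sub>E UNIV"
        using iota_type by (auto simp: PiE_iff)
      fix i assume i: "i \<in> {..<m}"
      then have p: "point i \<in> {..<1} \<rightarrow>\<^sub>E {..<m}"
        by (auto simp: point_def)
      have "act (S_obj C) 1 m (point i) (iota C 1 0) = iota C m i"
        using i p by (subst act_S_obj) (auto simp: iota_in msub_iota point_def)
      then show "iota (C_obj (S_obj C)) m i = iota C m i"
        using i by (simp add: C_obj_def var_S_obj)
    qed
  qed
qed simp

end

section \<open>Clone homomorphisms as algebra homomorphisms\<close>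

lemma subst_alg_hom_S_obj:
  assumes C: "abstract_clone C" and C': "abstract_clone C'" and h: "clone_hom C C' h"
  shows "subst_alg_hom (S_obj C) (S_obj C') h"
proof -
  interpret C: abstract_clone C by fact
  interpret C': abstract_clone C' by fact
  have h_msub: "h n (C.msub m n x y) = C'.msub m n (h m x) (\<lambda>i. h n (y i))"
    if "x \<in> cset C m" "\<And>i. i < m \<Longrightarrow> y i \<in> cset C n" for m n x y
  proof -
    have "restrict y {..<m} \<in> {..<m} \<rightarrow>\<^sub>E cset C n"
      using that(2) by auto
    then have "h n (C.msub m n x y) = mu C' m n (h m x) (\<lambda>j\<in>{..<m}. h n (restrict y {..<m} j))"
      unfolding C.msub_def by (rule clone_homD(3)[OF h that(1)])
    also have "(\<lambda>j\<in>{..<m}. h n (restrict y {..<m} j)) = (\<lambda>j\<in>{..<m}. h n (y j))"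
      by auto
    finally show ?thesis
      unfolding C'.msub_def .
  qed
  show ?thesis
  proof (rule subst_alg_homI)
    show "h m \<in> aset (S_obj C) m \<rightarrow>\<^sub>E aset (S_obj C') m" for m
      using clone_homD(1)[OF h] by simp
    show "h (m + 1) (var (S_obj C) m) = var (S_obj C') m" for m
      using clone_homD(4)[OF h, of m "Suc m"] by (simp add: C.var_S_obj C'.var_S_obj)
    fix m n f x
    assume "f \<in> hom FF m n" and "x \<in> aset (S_obj C) m"
    then have f: "f \<in> {..<m} \<rightarrow>\<^sub>E {..<n}" and x: "x \<in> cset C m"
      by simp_all
    have fi: "f i < n" if "i < m" for i
      using f that by auto
    have "C'.msub m n (h m x) (\<lambda>i. h n (iota C n (f i))) = C'.msub m n (h m x) (\<lambda>i. iota C' n (f i))"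
      using fi by (intro C'.msub_cong clone_homD(4)[OF h])
    then show "h n (act (S_obj C) m n f x) = act (S_obj C') m n f (h m x)"
      using f x fi clone_homD(2)[OF h x]
      by (simp add: C.act_S_obj C'.act_S_obj h_msub C.iota_in)
  next
    fix m x y
    assume "x \<in> aset (S_obj C) (m + 1)" and "y \<in> aset (S_obj C) m"
    then have x: "x \<in> cset C (Suc m)" and y: "y \<in> cset C m"
      by simp_all
    have "h m (C.msub (Suc m) m x (\<lambda>i. if i < m then iota C m i else y))
        = C'.msub (Suc m) m (h (Suc m) x) (\<lambda>i. h m (if i < m then iota C m i else y))"
      using x y by (intro h_msub) (auto intro: C.iota_in)
    also have "\<dots> = C'.msub (Suc m) m (h (Suc m) x) (\<lambda>i. if i < m then iota C' m i else h m y)"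
      by (rule C'.msub_cong) (simp add: clone_homD(4)[OF h])
    finally show "h m (sub (S_obj C) m x y) = sub (S_obj C') m (h (m + 1) x) (h m y)"
      using x y clone_homD(2)[OF h] by (simp add: C.sub_S_obj C'.sub_S_obj)
  qed
qed

section \<open>The isomorphism of categories\<close>

lemma subst_alg_hom_id:
  assumes "substitution_algebra A"
  shows "subst_alg_hom A A (\<lambda>m. \<lambda>x\<in>aset A m. x)"
proof -
  interpret substitution_algebra A by fact
  show ?thesis
  proof (rule subst_alg_homI)
    fix m n f x
    assume "f \<in> hom FF m n" and "x \<in> aset A m"
    then show "(\<lambda>x\<in>aset A n. x) (act A m n f x) = act A m n f ((\<lambda>x\<in>aset A m. x) x)"
      by (simp add: act_in del: FF_simps)
  qed (simp_all add: sub_in var_in)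
qed

lemma subst_alg_hom_compose:
  assumes A: "substitution_algebra A" and h: "subst_alg_hom A A' h" and g: "subst_alg_hom A' A'' g"
  shows "subst_alg_hom A A'' (\<lambda>m. compose (aset A m) (g m) (h m))"
proof -
  interpret substitution_algebra A by fact
  show ?thesis
  proof (rule subst_alg_homI)
    show "compose (aset A m) (g m) (h m) \<in> aset A m \<rightarrow>\<^sub>E aset A'' m" for m
      using compose_PiE subst_alg_homD(1)[OF h] subst_alg_homD(1)[OF g] .
    show "compose (aset A (m + 1)) (g (m + 1)) (h (m + 1)) (var A m) = var A'' m" for m
      unfolding compose_eq[OF var_type] subst_alg_homD(4)[OF h] subst_alg_homD(4)[OF g] ..
  next
    fix m n f x
    assume f: "f \<in> hom FF m n" and x: "x \<in> aset A m"
    have "act A m n f x \<in> aset A n"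
      using f x by (rule act_in)
    then show "compose (aset A n) (g n) (h n) (act A m n f x)
        = act A'' m n f (compose (aset A m) (g m) (h m) x)"
      using subst_alg_homD(3)[OF h f x] subst_alg_homD(3)[OF g f subst_alg_homD(2)[OF h x]] x
      by (simp only: compose_eq)
  next
    fix m x y
    assume x: "x \<in> aset A (m + 1)" and y: "y \<in> aset A m"
    have "sub A m x y \<in> aset A m"
      using x y by (simp add: sub_in)
    then show "compose (aset A m) (g m) (h m) (sub A m x y)
        = sub A'' m (compose (aset A (m + 1)) (g (m + 1)) (h (m + 1)) x)
            (compose (aset A m) (g m) (h m) y)"
      using subst_alg_homD(5)[OF h x y] x y
        subst_alg_homD(5)[OF g subst_alg_homD(2)[OF h x] subst_alg_homD(2)[OF h y]]
      by (simp only: compose_eq)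
  qed
qed

lemma category_SA: "category SA"
  by (unfold_locales; unfold SA_simps mem_Collect_eq)
    (erule subst_alg_hom_id
      | erule subst_alg_hom_compose, assumption, assumption
      | rule ext, erule subst_alg_homD(1)[THEN compose_id_right]
      | rule ext, erule subst_alg_homD(1)[THEN compose_id_left]
      | rule ext, erule subst_alg_homD(1)[THEN compose_assoc_PiE])+

section \<open>The functors and their composites\<close>

lemma functor_S: "cat_functor AC SA S_func"
proof (intro cat_functor.intro category_AC category_SA cat_functor_axioms.intro)
  show "fobj S_func \<in> obj AC \<rightarrow>\<^sub>E obj SA"
    by (simp add: S_func_def abstract_clone.substitution_algebra_S_obj)
  show "farr S_func \<in> (\<Pi>\<^sub>E X\<in>obj AC. \<Pi>\<^sub>E Y\<in>obj AC.
      hom AC X Y \<rightarrow>\<^sub>E hom SA (fobj S_func X) (fobj S_func Y))"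
    by (simp add: S_func_def subst_alg_hom_S_obj)
qed (simp_all add: S_func_def clone_hom_id clone_hom_compose abstract_clone.aset_S_obj)

lemma functor_C: "cat_functor SA AC C_func"
proof (intro cat_functor.intro category_AC category_SA cat_functor_axioms.intro)
  show "fobj C_func \<in> obj SA \<rightarrow>\<^sub>E obj AC"
    by (simp add: C_func_def substitution_algebra.abstract_clone_C_obj)
  show "farr C_func \<in> (\<Pi>\<^sub>E X\<in>obj SA. \<Pi>\<^sub>E Y\<in>obj SA.
      hom SA X Y \<rightarrow>\<^sub>E hom AC (fobj C_func X) (fobj C_func Y))"
    by (simp add: C_func_def clone_hom_C_obj)
qed (simp_all add: C_func_def subst_alg_hom_id subst_alg_hom_compose
    substitution_algebra.cset_C_obj)

text \<open>On arrows both functors are identities truncated to the hom-sets, and so is the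
  composite; on objects the claim is \<open>C_obj_S_obj\<close>.\<close>

lemma C_comp_S: "comp_func AC C_func S_func = id_func AC"
  unfolding comp_func_def id_func_def
  by (auto simp: S_func_def C_func_def abstract_clone.substitution_algebra_S_obj
      abstract_clone.C_obj_S_obj subst_alg_hom_S_obj fun_eq_iff restrict_def)

lemma S_comp_C: "comp_func SA S_func C_func = id_func SA"
  unfolding comp_func_def id_func_def
  by (auto simp: S_func_def C_func_def substitution_algebra.abstract_clone_C_obj
      substitution_algebra.S_obj_C_obj clone_hom_C_obj fun_eq_iff restrict_def)

theorem theorem5p3:
  "cat_functor (AC :: ('a clone, nat \<Rightarrow> 'a \<Rightarrow> 'a) cat) SA S_func \<and>
   cat_functor (SA :: ('a subst_alg, nat \<Rightarrow> 'a \<Rightarrow> 'a) cat) AC C_func \<and>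
   comp_func AC C_func S_func = id_func (AC :: ('a clone, nat \<Rightarrow> 'a \<Rightarrow> 'a) cat) \<and>
   comp_func SA S_func C_func = id_func (SA :: ('a subst_alg, nat \<Rightarrow> 'a \<Rightarrow> 'a) cat)"
  using functor_S functor_C C_comp_S S_comp_C by blast

end
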